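(* Let $J$ be a uniform normal $\nu$-saturated ideal on a cardinal $\kappa$ for some $\nu<\kappa$, and let $n\in\omega$. If a poset $P$ is $\sigma$-$w$-finite-c.c., then $P$ is $J^{n+1}$-Knaster.
   Context: All ideals are proper ($\kappa\notin J$) and uniform ($[\kappa]^{<\kappa}\subseteq J$); $J^*$ is the dual filter, $J^+$ the positive sets; normality is in the usual sense. $J$ is $\nu$-saturated if for every $\langle X_i:i<\nu\rangle\subseteq J^+$ there are $i<j<\nu$ with $X_i\cap X_j\in J^+$. For $n\ge1$, $[\kappa]^n$ is the set of strictly increasing $n$-tuples from $\kappa$, identified with $n$-element subsets. Fubini powers: $J^1=J$, and for $n\ge2$, $X\subseteq[\kappa]^n$ is in $J^n$ iff $\{\alpha:\{\bar\beta\in[\kappa]^{n-1}:(\alpha,\bar\beta)\in X\}\in J^{n-1}\}\in J^*$; $(J^n)^+$ denotes the $J^n$-positive sets. For $a,b\in[\kappa]^n$, $a\simeq b$ means the order-preserving bijection from $a$ onto $b$ is the identity on $a\cap b$. A poset $P$ is $J^n$-Knaster if for every $X\in(J^n)^+$ and every $\langle p_a\in P:a\in X\rangle$ there is $Y\subseteq X$, $Y\in(J^n)^+$, such that for all $a,b\in Y$ with $a\simeq b$, $p_a$ and $p_b$ are compatible. A poset $P$ is $\sigma$-$w$-finite-c.c. if $P=\bigcup_{k\in\omega}P_k$ for some sets $P_k$ such that for each $k$ and each sequence $\langle(p_i,q_i):i\in\omega\rangle\subseteq P_k\times P_k$ with $p_i$ compatible with $q_i$ for every $i$, there exist $i<j$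 such that $p_i$ is compatible with $q_j$. *)

theory Defs
  imports Main
begin

unbundle cardinal_syntax

text \<open>
  A cardinal \<open>\<kappa>\<close> is rendered as a type \<open>'k\<close> of class \<open>wellorder\<close> whose order is an initial ordinal
  (\<open>is_cardinal\<close> below).  The elements of \<open>'k\<close> are then the ordinals below \<open>\<kappa>\<close>; an ordinal
  \<open>\<nu> < \<kappa>\<close> is an element of \<open>'k\<close>, and \<open>i < \<nu>\<close> is the order of \<open>'k\<close>.
\<close>

definition is_cardinal :: "'k::wellorder itself \<Rightarrow> bool" where
  "is_cardinal _ \<longleftrightarrow> card_order {(x::'k, y). x \<le> y}"

definition proper_ideal :: "'k set set \<Rightarrow> bool" where
  "proper_ideal J \<longleftrightarrow>
     {} \<in> J \<and>
     (\<forall>X Y. X \<in> J \<longrightarrow> Y \<subseteq> X \<longrightarrow> Y \<in> J) \<and>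
     (\<forall>X Y. X \<in> J \<longrightarrow> Y \<in> J \<longrightarrow> X \<union> Y \<in> J) \<and>
     UNIV \<notin> J"

definition uniform_ideal :: "'k set set \<Rightarrow> bool" where
  "uniform_ideal J \<longleftrightarrow> (\<forall>X. |X| <o |UNIV :: 'k set| \<longrightarrow> X \<in> J)"

text \<open>Normality is closure under diagonal unions.\<close>

definition normal_ideal :: "'k::wellorder set set \<Rightarrow> bool" where
  "normal_ideal J \<longleftrightarrow>
     (\<forall>X :: 'k \<Rightarrow> 'k set. (\<forall>\<alpha>. X \<alpha> \<in> J) \<longrightarrow> {\<beta>. \<exists>\<alpha><\<beta>. \<beta> \<in> X \<alpha>} \<in> J)"

definition dual_filter :: "'k set set \<Rightarrow> 'k set set" where
  "dual_filter J = {X. - X \<in> J}"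

definition positive_sets :: "'k set set \<Rightarrow> 'k set set" where
  "positive_sets J = {X. X \<notin> J}"

definition saturated :: "'k::wellorder \<Rightarrow> 'k set set \<Rightarrow> bool" where
  "saturated \<nu> J \<longleftrightarrow>
     (\<forall>X :: 'k \<Rightarrow> 'k set. (\<forall>i<\<nu>. X i \<in> positive_sets J) \<longrightarrow>
        (\<exists>i j. i < j \<and> j < \<nu> \<and> X i \<inter> X j \<in> positive_sets J))"

definition tuples :: "nat \<Rightarrow> 'k::wellorder list set" where
  "tuples n = {xs. length xs = n \<and> sorted_wrt (<) xs}"

text \<open>
  The Fubini power \<open>J\<^sup>n\<close>, an ideal on \<open>tuples n\<close>; it is only specified for \<open>n \<ge> 1\<close>.
  The first equation is \<open>J\<^sup>1 = J\<close>, with the 1-tuple \<open>[\<alpha>]\<close> identified with \<open>\<alpha>\<close>.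
\<close>

fun fubini_power :: "'k::wellorder set set \<Rightarrow> nat \<Rightarrow> 'k list set set" where
  "fubini_power J (Suc 0) = {X. X \<subseteq> tuples (Suc 0) \<and> {\<alpha>. [\<alpha>] \<in> X} \<in> J}"
| "fubini_power J (Suc (Suc n)) =
     {X. X \<subseteq> tuples (Suc (Suc n)) \<and>
         {\<alpha>. {\<beta> \<in> tuples (Suc n). \<alpha> # \<beta> \<in> X} \<in> fubini_power J (Suc n)} \<in> dual_filter J}"

definition fubini_positive :: "'k::wellorder set set \<Rightarrow> nat \<Rightarrow> 'k list set set" where
  "fubini_positive J n = {X. X \<subseteq> tuples n \<and> X \<notin> fubini_power J n}"

text \<open>For finite \<open>a\<close>, \<open>b\<close> of the same size, the order-preserving bijection \<open>f\<close> exists and is unique on \<open>a\<close>.\<close>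

definition similar :: "'k::wellorder set \<Rightarrow> 'k set \<Rightarrow> bool" where
  "similar a b \<longleftrightarrow>
     (\<exists>f. bij_betw f a b \<and> strict_mono_on a f \<and> (\<forall>x \<in> a \<inter> b. f x = x))"

text \<open>A poset is a carrier \<open>P\<close> with a relation \<open>le\<close>, where \<open>(r, p) \<in> le\<close> means \<open>r \<le> p\<close>.\<close>

definition compatible :: "'p set \<Rightarrow> 'p rel \<Rightarrow> 'p \<Rightarrow> 'p \<Rightarrow> bool" where
  "compatible P le p q \<longleftrightarrow> (\<exists>r\<in>P. (r, p) \<in> le \<and> (r, q) \<in> le)"

definition fubini_Knaster :: "'k::wellorder set set \<Rightarrow> nat \<Rightarrow> 'p set \<Rightarrow> 'p rel \<Rightarrow> bool" where
  "fubini_Knaster J n P le \<longleftrightarrow>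
     (\<forall>X \<in> fubini_positive J n. \<forall>p :: 'k list \<Rightarrow> 'p. (\<forall>a\<in>X. p a \<in> P) \<longrightarrow>
        (\<exists>Y \<in> fubini_positive J n. Y \<subseteq> X \<and>
           (\<forall>a\<in>Y. \<forall>b\<in>Y. similar (set a) (set b) \<longrightarrow> compatible P le (p a) (p b))))"

definition sigma_w_finite_cc :: "'p set \<Rightarrow> 'p rel \<Rightarrow> bool" where
  "sigma_w_finite_cc P le \<longleftrightarrow>
     (\<exists>A :: nat \<Rightarrow> 'p set. P = (\<Union>k. A k) \<and>
        (\<forall>k. \<forall>p q :: nat \<Rightarrow> 'p.
           (\<forall>i. p i \<in> A k \<and> q i \<in> A k \<and> compatible P le (p i) (q i)) \<longrightarrow>
           (\<exists>i j. i < j \<and> compatible P le (p i) (q j))))"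

end

theory Submission
  imports Defs
begin

text \<open>
  Thin out so that all \<open>p a\<close> lie in one piece \<open>Q\<close> of \<open>P\<close>.  The chain condition says that compatibility
  on \<open>Q\<close> has no infinite half graph, so the sets of elements incompatible with all of a given set
  form a lattice \<open>L\<close> without infinite descending chains.  For a set \<open>r\<close> of coordinates let \<open>D r\<close> be
  a function from \<open>r\<close>-tuples to \<open>L\<close> with \<open>p a \<in> D r (a restricted to r)\<close> that is minimal modulo
  null sets; it exists after shrinking \<open>X\<close>, since the generic ultrapower by a saturated ideal is
  well-founded.  By minimality, whether \<open>D r\<close> is incompatible with a given set is unchanged almost
  everywhere when a further coordinate is added to \<open>r\<close>.  Two similar tuples start, on their
  common coordinates, with the same nonempty hull, and adding the other coordinates from left to
  right, in the order in which they are interleaved, gives that \<open>p a\<close> and \<open>p b\<close> are compatible for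
  almost all pairs of each of the finitely many types.  Normality makes this hold everywhere on
  a positive set.
\<close>

section \<open>Complete saturated ideals\<close>

text \<open>One cardinal serves both as the degree of completeness and as the bound on disjoint
  families of positive sets, so that constructions on the members of a maximal disjoint family can
  be glued with only a null loss. The ideal may be improper, so that \<open>image_ideal\<close> also
  holds for null \<open>A\<close>.\<close>

locale complete_saturated_ideal =
  fixes N :: "'a set set" and \<Lambda> :: "'l set"
  assumes infinite_bound: "infinite \<Lambda>"
    and subset_mem: "X \<in> N \<Longrightarrow> Y \<subseteq> X \<Longrightarrow> Y \<in> N"
    and Union_mem: "\<F> \<subseteq> N \<Longrightarrow> |\<F>| \<le>o |\<Lambda>| \<Longrightarrow> \<Union>\<F> \<in> N"
    and card_disjoint_positive: "pairwise disjnt \<F> \<Longrightarrow> \<F> \<inter> N = {} \<Longrightarrow> |\<F>| \<le>o |\<Lambda>|"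
begin

lemma UN_mem:
  assumes "\<And>i. i \<in> I \<Longrightarrow> A i \<in> N" "|I| \<le>o |\<Lambda>|"
  shows "(\<Union>i\<in>I. A i) \<in> N"
  by (rule Union_mem) (use assms card_of_image ordLeq_transitive in blast)+

lemma finite_card_le: "finite I \<Longrightarrow> |I| \<le>o |\<Lambda>|"
  using infinite_bound by (intro ordLess_imp_ordLeq finite_ordLess_infinite card_of_Well_order)
    (simp_all add: Field_card_of)

lemma UN_nat_mem: "(\<And>i::nat. A i \<in> N) \<Longrightarrow> (\<Union>i. A i) \<in> N"
  by (rule UN_mem) (use infinite_bound infinite_iff_card_of_nat in auto)

lemma empty_mem: "{} \<in> N"
  using UN_mem[of "{}"] finite_card_le by auto

lemma Un_mem:
  assumes "X \<in> N" "Y \<in> N"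
  shows "X \<union> Y \<in> N"
  using Union_mem[of "{X, Y}"] assms finite_card_le[of "{X, Y}"] by auto

text \<open>This is the push-forward along \<open>\<pi>\<close> of the restriction of
  \<open>N\<close> to \<open>A\<close>. Preimages commute with unions and preserve disjointness, and
  positive sets have nonempty, hence distinct, preimages, so disjoint families keep their
  size.\<close>

lemma image_ideal:
  "complete_saturated_ideal {B. A \<inter> \<pi> -` B \<in> N} \<Lambda>"
proof
  show "infinite \<Lambda>" by (rule infinite_bound)
next
  fix X Y assume "X \<in> {B. A \<inter> \<pi> -` B \<in> N}" "Y \<subseteq> X"
  then show "Y \<in> {B. A \<inter> \<pi> -` B \<in> N}"
    using subset_mem[of "A \<inter> \<pi> -` X" "A \<inter> \<pi> -` Y"] by auto
next
  fix \<F> assume "\<F> \<subseteq> {B. A \<inter> \<pi> -` B \<in> N}" "|\<F>| \<le>o |\<Lambda>|"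
  then have "(\<Union>B\<in>\<F>. A \<inter> \<pi> -` B) \<in> N"
    by (intro UN_mem) auto
  also have "(\<Union>B\<in>\<F>. A \<inter> \<pi> -` B) = A \<inter> \<pi> -` \<Union>\<F>" by auto
  finally show "\<Union>\<F> \<in> {B. A \<inter> \<pi> -` B \<in> N}" by simp
next
  fix \<F> assume dis: "pairwise disjnt \<F>" and pos: "\<F> \<inter> {B. A \<inter> \<pi> -` B \<in> N} = {}"
  let ?g = "\<lambda>B. A \<inter> \<pi> -` B"
  have pos': "?g B \<notin> N" "?g B \<noteq> {}" if "B \<in> \<F>" for B
    using that pos empty_mem by (blast, force)
  have "disjnt (?g B) (?g C)" if "B \<in> \<F>" "C \<in> \<F>" "B \<noteq> C" for B C
    using that dis unfolding pairwise_def disjnt_def by blast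
  moreover from this have "inj_on ?g \<F>"
    using pos' by (metis (no_types, lifting) disjnt_self_iff_empty inj_onI)
  ultimately have "|?g ` \<F>| \<le>o |\<Lambda>|"
    using pos' by (intro card_disjoint_positive) (auto simp: pairwise_def)
  moreover have "|\<F>| =o |?g ` \<F>|"
    using \<open>inj_on ?g \<F>\<close> by (rule card_of_ordIsoI[OF inj_on_imp_bij_betw])
  ultimately show "|\<F>| \<le>o |\<Lambda>|"
    by (rule ordIso_ordLeq_trans[rotated])
qed

text \<open>Zorn's lemma gives a maximal disjoint family of positive members of \<open>\<D>\<close>.
  A positive remainder would contain a further member, against maximality.\<close>

lemma exhaustion:
  assumes dense: "\<And>C. C \<subseteq> B \<Longrightarrow> C \<notin> N \<Longrightarrow> \<exists>D\<in>\<D>. D \<subseteq> C \<and> D \<notin> N"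
  obtains \<F> where "\<F> \<subseteq> \<D>" "pairwise disjnt \<F>" "|\<F>| \<le>o |\<Lambda>|" "B - \<Union>\<F> \<in> N"
proof -
  let ?\<C> = "{\<F>. \<F> \<subseteq> \<D> - N \<and> pairwise disjnt \<F>}"
  have "\<exists>M\<in>?\<C>. \<forall>X\<in>?\<C>. M \<subseteq> X \<longrightarrow> X = M"
  proof (rule subset_Zorn')
    fix C assume C: "subset.chain ?\<C> C"
    then have "pairwise disjnt (\<Union>C)"
      by (intro pairwise_chain_Union) (auto simp: subset_chain_def chain_subset_def)
    with C show "\<Union>C \<in> ?\<C>" by (auto simp: subset_chain_def)
  qed
  then obtain \<F> where \<F>: "\<F> \<subseteq> \<D> - N" "pairwise disjnt \<F>"
    and max: "\<And>\<G>. \<G> \<in> ?\<C> \<Longrightarrow> \<F> \<subseteq> \<G> \<Longrightarrow> \<G> = \<F>" by auto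
  have "B - \<Union>\<F> \<in> N"
  proof (rule ccontr)
    assume "B - \<Union>\<F> \<notin> N"
    then obtain D where D: "D \<in> \<D>" "D \<subseteq> B - \<Union>\<F>" "D \<notin> N"
      using dense[of "B - \<Union>\<F>"] by auto
    then have "insert D \<F> \<in> ?\<C>"
      using \<F> by (auto simp: pairwise_insert disjnt_def)
    then have "D \<in> \<F>" using max by blast
    then have "D = {}" using D by auto
    with D empty_mem show False by auto
  qed
  moreover have "|\<F>| \<le>o |\<Lambda>|"
    using \<F> by (intro card_disjoint_positive) auto
  ultimately show ?thesis using \<F> that by blast
qed

text \<open>This is the well-foundedness of the generic ultrapower.  If there were no minimal \<open>D\<close>,
  a descending sequence of functions could be glued along maximal disjoint families
  of subsets of the range of \<open>\<pi>\<close> in such a way that it descends almost everywhere.\<close>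

lemma minimal_function:
  fixes \<pi> :: "'a \<Rightarrow> 'e" and G :: "'a \<Rightarrow> 'b \<Rightarrow> bool"
  assumes wf: "\<And>f :: nat \<Rightarrow> 'b. \<exists>i. \<not> lt (f (Suc i)) (f i)"
    and pos: "A\<^sub>0 \<notin> N" and top: "\<And>a. a \<in> A\<^sub>0 \<Longrightarrow> G a t"
  obtains A D where "A \<subseteq> A\<^sub>0" "A \<notin> N" "\<And>a. a \<in> A \<Longrightarrow> G a (D (\<pi> a))"
    "\<And>F. {a \<in> A. G a (F (\<pi> a)) \<and> lt (F (\<pi> a)) (D (\<pi> a))} \<in> N"
proof (rule ccontr)
  assume "\<not> thesis"
  then have "\<not> (\<exists>A D. A \<subseteq> A\<^sub>0 \<and> A \<notin> N \<and> (\<forall>a\<in>A. G a (D (\<pi> a))) \<and>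
      (\<forall>F. {a \<in> A. G a (F (\<pi> a)) \<and> lt (F (\<pi> a)) (D (\<pi> a))} \<in> N))"
    using that by meson
  \<comment> \<open>If no pair \<open>A\<close>, \<open>D\<close> is minimal, every admissible
    \<open>D\<close> can be lowered on a positive part of its domain.\<close>
  then have refine: "\<exists>A'\<subseteq>A. A' \<notin> N \<and> (\<exists>F. \<forall>a\<in>A'. G a (F (\<pi> a)) \<and> lt (F (\<pi> a)) (D (\<pi> a)))"
    if "A \<subseteq> A\<^sub>0" "A \<notin> N" "\<forall>a\<in>A. G a (D (\<pi> a))" for A D
    using that by (smt (verit) mem_Collect_eq subsetI)
  define I where "I = {B. A\<^sub>0 \<inter> \<pi> -` B \<in> N}"
  interpret I: complete_saturated_ideal I \<Lambda>
    unfolding I_def by (rule image_ideal)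
  \<comment> \<open>Fullness transfers facts from \<open>A\<close> to the range of
    \<open>\<pi>\<close>: an index set over which \<open>A\<close> is null must be
    \<open>I\<close>-null. A merely positive \<open>A\<close> would not allow infinitely many
    descents to be combined.\<close>
  define full where "full A \<longleftrightarrow> A \<subseteq> A\<^sub>0 \<and> (\<forall>B. A \<inter> \<pi> -` B \<in> N \<longrightarrow> B \<in> I)" for A
  have step: "\<exists>A' D'. A' \<subseteq> A \<and> full A' \<and> (\<forall>a\<in>A'. G a (D' (\<pi> a)) \<and> lt (D' (\<pi> a)) (D (\<pi> a)))"
    if A: "full A" "\<forall>a\<in>A. G a (D (\<pi> a))" for A D
  proof -
    \<comment> \<open>A piece \<open>B\<close> of the range is good if \<open>D\<close> can be
      lowered on some \<open>A'\<close> lying over \<open>B\<close> that is full relative to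
      \<open>B\<close>.\<close>
    let ?P = "\<lambda>B A' F. A' \<subseteq> A \<inter> \<pi> -` B \<and> (\<forall>a\<in>A'. G a (F (\<pi> a)) \<and> lt (F (\<pi> a)) (D (\<pi> a))) \<and>
        (\<forall>C\<subseteq>B. A' \<inter> \<pi> -` C \<in> N \<longrightarrow> C \<in> I)"
    have "\<exists>B'\<in>{B. \<exists>A' F. ?P B A' F}. B' \<subseteq> B \<and> B' \<notin> I" if "B \<notin> I" for B
    proof -
      from that A have "A \<inter> \<pi> -` B \<notin> N" by (auto simp: full_def)
      then obtain A'' F where A'': "A'' \<subseteq> A \<inter> \<pi> -` B" "A'' \<notin> N"
        and F: "\<forall>a\<in>A''. G a (F (\<pi> a)) \<and> lt (F (\<pi> a)) (D (\<pi> a))"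
        using refine[of "A \<inter> \<pi> -` B" D] A unfolding full_def by (metis Int_iff le_infI1)
      \<comment> \<open>Otherwise almost all of \<open>B\<close> is covered by at most
        \<open>|\<Lambda>|\<close> sets over which \<open>A''\<close> is null, and then
        \<open>A''\<close> itself is null by completeness.\<close>
      have "\<exists>B1\<subseteq>B. B1 \<notin> I \<and> (\<forall>C\<subseteq>B1. A'' \<inter> \<pi> -` C \<in> N \<longrightarrow> C \<in> I)"
      proof (rule ccontr)
        assume "\<not> ?thesis"
        then have "\<And>C. C \<subseteq> B \<Longrightarrow> C \<notin> I \<Longrightarrow> \<exists>D\<in>{C. A'' \<inter> \<pi> -` C \<in> N}. D \<subseteq> C \<and> D \<notin> I"
          by blast
        then obtain \<F> where \<F>: "\<F> \<subseteq> {C. A'' \<inter> \<pi> -` C \<in> N}" "|\<F>| \<le>o |\<Lambda>|" "B - \<Union>\<F> \<in> I"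
          by (rule I.exhaustion) blast
        have "(\<Union>C\<in>\<F>. A'' \<inter> \<pi> -` C) \<in> N" using \<F> by (intro UN_mem) auto
        moreover have "A\<^sub>0 \<inter> \<pi> -` (B - \<Union>\<F>) \<in> N" using \<F> by (simp add: I_def)
        moreover have "A'' \<subseteq> (\<Union>C\<in>\<F>. A'' \<inter> \<pi> -` C) \<union> (A\<^sub>0 \<inter> \<pi> -` (B - \<Union>\<F>))"
          using A'' A by (auto simp: full_def)
        ultimately show False using A'' Un_mem subset_mem by blast
      qed
      then obtain B1 where B1: "B1 \<subseteq> B" "B1 \<notin> I" "\<forall>C\<subseteq>B1. A'' \<inter> \<pi> -` C \<in> N \<longrightarrow> C \<in> I"
        by blast
      have "A'' \<inter> \<pi> -` B1 \<inter> \<pi> -` C = A'' \<inter> \<pi> -` C" if "C \<subseteq> B1" for C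
        using that by auto
      then have "?P B1 (A'' \<inter> \<pi> -` B1) F" using B1 A'' F by auto
      then have "\<exists>A' F. ?P B1 A' F" by (intro exI)
      with B1 show ?thesis by (intro bexI[of _ B1] conjI CollectI) auto
    qed
    then obtain \<F> where \<F>: "\<F> \<subseteq> {B. \<exists>A' F. ?P B A' F}" "pairwise disjnt \<F>"
        "|\<F>| \<le>o |\<Lambda>|" "UNIV - \<Union>\<F> \<in> I"
      by (rule I.exhaustion)
    then have "\<forall>B\<in>\<F>. \<exists>A' F. ?P B A' F" by auto
    then obtain A' F where A'F: "\<And>B. B \<in> \<F> \<Longrightarrow> ?P B (A' B) (F B)" by metis
    \<comment> \<open>The functions on the disjoint pieces are glued. The values of
      \<open>?F\<close> off \<open>\<Union>\<F>\<close> are irrelevant, as no point of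
      \<open>?A\<close> lies over them.\<close>
    let ?A = "\<Union>B\<in>\<F>. A' B" and ?F = "\<lambda>e. F (THE B. B \<in> \<F> \<and> e \<in> B) e"
    have F_eq: "?F e = F B e" if "B \<in> \<F>" "e \<in> B" for B e
    proof -
      have "(THE B. B \<in> \<F> \<and> e \<in> B) = B"
        using that \<F>(2) by (intro the_equality) (auto simp: pairwise_def disjnt_def)
      then show ?thesis by simp
    qed
    have "full ?A"
      unfolding full_def
    proof (intro conjI allI impI)
      show "?A \<subseteq> A\<^sub>0" using A'F A by (fastforce simp: full_def)
      fix C assume C: "?A \<inter> \<pi> -` C \<in> N"
      have "C \<inter> B \<in> I" if "B \<in> \<F>" for B
      proof -
        have "A' B \<inter> \<pi> -` (C \<inter> B) \<in> N"
          by (rule subset_mem[OF C]) (use that in auto)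
        then show ?thesis using A'F[OF that] by blast
      qed
      then have "(\<Union>B\<in>\<F>. C \<inter> B) \<in> I" using \<F> by (intro I.UN_mem) auto
      then have "(\<Union>B\<in>\<F>. C \<inter> B) \<union> (UNIV - \<Union>\<F>) \<in> I" using \<F> by (intro I.Un_mem)
      then show "C \<in> I" by (rule I.subset_mem) auto
    qed
    moreover have "\<forall>a\<in>?A. G a (?F (\<pi> a)) \<and> lt (?F (\<pi> a)) (D (\<pi> a))"
    proof
      fix a assume "a \<in> ?A"
      then obtain B where B: "B \<in> \<F>" "a \<in> A' B" by auto
      then have "\<pi> a \<in> B" using A'F by blast
      then show "G a (?F (\<pi> a)) \<and> lt (?F (\<pi> a)) (D (\<pi> a))"
        using A'F[OF B(1)] B F_eq[OF B(1)] by auto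
    qed
    moreover have "?A \<subseteq> A" using A'F by blast
    ultimately show ?thesis by (intro exI[of _ ?A] exI[of _ ?F] conjI)
  qed
  have "\<exists>f :: nat \<Rightarrow> 'a set \<times> ('e \<Rightarrow> 'b). \<forall>i.
      (full (fst (f i)) \<and> (\<forall>a\<in>fst (f i). G a (snd (f i) (\<pi> a)))) \<and>
      (\<forall>a\<in>fst (f (Suc i)). lt (snd (f (Suc i)) (\<pi> a)) (snd (f i) (\<pi> a)))"
  proof (rule dependent_nat_choice)
    show "\<exists>x. full (fst x) \<and> (\<forall>a\<in>fst x. G a (snd x (\<pi> a)))"
      using top by (intro exI[of _ "(A\<^sub>0, \<lambda>_. t)"]) (auto simp: full_def I_def)
  next
    fix x :: "'a set \<times> ('e \<Rightarrow> 'b)" and i :: nat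
    assume "full (fst x) \<and> (\<forall>a\<in>fst x. G a (snd x (\<pi> a)))"
    then obtain A' D' where "full A'" "\<forall>a\<in>A'. G a (D' (\<pi> a)) \<and> lt (D' (\<pi> a)) (snd x (\<pi> a))"
      using step[of "fst x" "snd x"] by blast
    then show "\<exists>y. (full (fst y) \<and> (\<forall>a\<in>fst y. G a (snd y (\<pi> a)))) \<and>
        (\<forall>a\<in>fst y. lt (snd y (\<pi> a)) (snd x (\<pi> a)))"
      by (intro exI[of _ "(A', D')"]) auto
  qed
  then obtain f :: "nat \<Rightarrow> 'a set \<times> ('e \<Rightarrow> 'b)" where full: "\<And>i. full (fst (f i))"
    and lt: "\<And>i a. a \<in> fst (f (Suc i)) \<Longrightarrow> lt (snd (f (Suc i)) (\<pi> a)) (snd (f i) (\<pi> a))"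
    by blast
  let ?E = "\<lambda>i. {e. lt (snd (f (Suc i)) e) (snd (f i) e)}"
  \<comment> \<open>By construction nothing of the full set \<open>fst (f (Suc i))\<close> lies over
    \<open>- ?E i\<close>. The sets \<open>?E i\<close> speak of indices alone, so they can be
    combined for all \<open>i\<close> without intersecting the domains.\<close>
  have "- ?E i \<in> I" for i
  proof -
    have "fst (f (Suc i)) \<inter> \<pi> -` (- ?E i) = {}" using lt by auto
    then show ?thesis using full[of "Suc i"] empty_mem by (auto simp: full_def)
  qed
  then have "(\<Union>i. - ?E i) \<in> I" by (rule I.UN_nat_mem)
  \<comment> \<open>An index in every \<open>?E i\<close> would carry an infinite descending
    sequence.\<close>
  moreover have "(\<Union>i. - ?E i) = UNIV"
    using wf[of "\<lambda>i. snd (f i) e" for e] by auto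
  ultimately show False using pos by (auto simp: I_def)
qed

end

section \<open>Fubini powers\<close>

text \<open>In contrast to \<open>fubini_power\<close>, arbitrary sets of lists are admitted and the recursion
  starts at 0, where the ideal on \<open>{[]}\<close> is the trivial one.\<close>

fun fubini_null :: "'k set set \<Rightarrow> nat \<Rightarrow> 'k list set set" where
  "fubini_null J 0 = {X. [] \<notin> X}"
| "fubini_null J (Suc n) = {X. {\<alpha>. Cons \<alpha> -` X \<notin> fubini_null J n} \<in> J}"

lemma fubini_power_iff_null:
  "X \<subseteq> tuples (Suc n) \<Longrightarrow> X \<in> fubini_power J (Suc n) \<longleftrightarrow> X \<in> fubini_null J (Suc n)"
proof (induction n arbitrary: X)
  case 0
  then show ?case by (simp add: vimage_def)
next
  case (Suc n)
  have "{\<beta> \<in> tuples (Suc n). \<alpha> # \<beta> \<in> X} = Cons \<alpha> -` X" for \<alpha>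
    using Suc.prems by (auto simp: tuples_def)
  moreover have "Cons \<alpha> -` X \<subseteq> tuples (Suc n)" for \<alpha>
    using Suc.prems by (auto simp: tuples_def)
  ultimately have "{\<beta> \<in> tuples (Suc n). \<alpha> # \<beta> \<in> X} \<in> fubini_power J (Suc n) \<longleftrightarrow>
      Cons \<alpha> -` X \<in> fubini_null J (Suc n)" for \<alpha>
    using Suc.IH[of "Cons \<alpha> -` X"] by simp
  then show ?case
    using Suc.prems
    by (simp only: fubini_power.simps(2) fubini_null.simps(2)[of J "Suc n"]) (simp add: dual_filter_def Collect_neg_eq)
qed

text \<open>The saturation of the Fubini power is Ulam's argument: the fibers over a point \<open>\<alpha>\<close> in a
  disjoint family are enumerated by \<open>\<Lambda>\<close>, and completeness fixes the place in the enumeration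
  on a positive set of \<open>\<alpha>\<close>.\<close>

lemma fubini_null_complete_saturated:
  assumes "complete_saturated_ideal J \<Lambda>"
  shows "complete_saturated_ideal (fubini_null J n) \<Lambda>"
proof (induction n)
  interpret J: complete_saturated_ideal J \<Lambda> by fact
  case 0
  show ?case
  proof
    fix \<F> :: "'a list set set"
    assume "pairwise disjnt \<F>" "\<F> \<inter> fubini_null J 0 = {}"
    moreover have "[] \<in> X" if "X \<in> \<F>" for X
      using that \<open>\<F> \<inter> fubini_null J 0 = {}\<close> by auto
    ultimately have "X = Y" if "X \<in> \<F>" "Y \<in> \<F>" for X Y
      using that unfolding pairwise_def disjnt_def by blast
    then have "\<exists>X. \<F> \<subseteq> {X}" by blast
    then have "finite \<F>" using finite_subset by blast
    then show "|\<F>| \<le>o |\<Lambda>|" by (rule J.finite_card_le)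
  qed (use J.infinite_bound in auto)
next
  case (Suc n)
  interpret J: complete_saturated_ideal J \<Lambda> by fact
  interpret N: complete_saturated_ideal "fubini_null J n" \<Lambda> by fact
  show ?case
  proof
    show "infinite \<Lambda>" by (rule J.infinite_bound)
  next
    fix X Y :: "'a list set" assume "X \<in> fubini_null J (Suc n)" "Y \<subseteq> X"
    moreover have "{\<alpha>. Cons \<alpha> -` Y \<notin> fubini_null J n} \<subseteq> {\<alpha>. Cons \<alpha> -` X \<notin> fubini_null J n}"
    proof
      fix \<alpha> assume "\<alpha> \<in> {\<alpha>. Cons \<alpha> -` Y \<notin> fubini_null J n}"
      then show "\<alpha> \<in> {\<alpha>. Cons \<alpha> -` X \<notin> fubini_null J n}"
        using N.subset_mem[OF _ vimage_mono[OF \<open>Y \<subseteq> X\<close>, of "Cons \<alpha>"]] by auto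
    qed
    ultimately show "Y \<in> fubini_null J (Suc n)" using J.subset_mem by simp
  next
    fix \<F> assume \<F>: "\<F> \<subseteq> fubini_null J (Suc n)" "|\<F>| \<le>o |\<Lambda>|"
    have "(\<Union>X\<in>\<F>. {\<alpha>. Cons \<alpha> -` X \<notin> fubini_null J n}) \<in> J"
      using \<F> by (intro J.UN_mem) auto
    moreover have "{\<alpha>. Cons \<alpha> -` \<Union>\<F> \<notin> fubini_null J n}
        \<subseteq> (\<Union>X\<in>\<F>. {\<alpha>. Cons \<alpha> -` X \<notin> fubini_null J n})"
    proof
      fix \<alpha> assume "\<alpha> \<in> {\<alpha>. Cons \<alpha> -` \<Union>\<F> \<notin> fubini_null J n}"
      then have "(\<Union>X\<in>\<F>. Cons \<alpha> -` X) \<notin> fubini_null J n" by (simp add: vimage_Union)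
      then show "\<alpha> \<in> (\<Union>X\<in>\<F>. {\<alpha>. Cons \<alpha> -` X \<notin> fubini_null J n})"
        using N.UN_mem[of \<F> "\<lambda>X. Cons \<alpha> -` X"] \<F>(2) by blast
    qed
    ultimately show "\<Union>\<F> \<in> fubini_null J (Suc n)" using J.subset_mem by simp
  next
    fix \<F> :: "'a list set set"
    assume dis: "pairwise disjnt \<F>" and pos: "\<F> \<inter> fubini_null J (Suc n) = {}"
    define B where "B X = {\<alpha>. Cons \<alpha> -` X \<notin> fubini_null J n}" for X
    have B: "B X \<notin> J" if "X \<in> \<F>" for X using that pos by (auto simp: B_def)
    have "\<forall>\<alpha>. \<exists>e. inj_on e {X \<in> \<F>. \<alpha> \<in> B X} \<and> e ` {X \<in> \<F>. \<alpha> \<in> B X} \<subseteq> \<Lambda>"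
    proof
      fix \<alpha>
      let ?\<F> = "{X \<in> \<F>. \<alpha> \<in> B X}"
      have dis': "disjnt (Cons \<alpha> -` X) (Cons \<alpha> -` Y)" if "X \<in> ?\<F>" "Y \<in> ?\<F>" "X \<noteq> Y" for X Y
        using that dis unfolding pairwise_def disjnt_def by blast
      have ne: "Cons \<alpha> -` X \<noteq> {}" if "X \<in> ?\<F>" for X
        using that N.empty_mem unfolding B_def by (metis (mono_tags, lifting) mem_Collect_eq)
      have "inj_on (\<lambda>X. Cons \<alpha> -` X) ?\<F>"
        using dis' ne by (metis (no_types, lifting) disjnt_self_iff_empty inj_onI)
      then have "|?\<F>| =o |(\<lambda>X. Cons \<alpha> -` X) ` ?\<F>|"
        by (rule card_of_ordIsoI[OF inj_on_imp_bij_betw])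
      moreover have "|(\<lambda>X. Cons \<alpha> -` X) ` ?\<F>| \<le>o |\<Lambda>|"
        using dis' by (intro N.card_disjoint_positive) (auto simp: pairwise_def B_def)
      ultimately have "|?\<F>| \<le>o |\<Lambda>|" by (rule ordIso_ordLeq_trans)
      then show "\<exists>e. inj_on e ?\<F> \<and> e ` ?\<F> \<subseteq> \<Lambda>"
        unfolding card_of_ordLeq[symmetric] .
    qed
    from choice[OF this] obtain e
      where "\<forall>\<alpha>. inj_on (e \<alpha>) {X \<in> \<F>. \<alpha> \<in> B X} \<and> e \<alpha> ` {X \<in> \<F>. \<alpha> \<in> B X} \<subseteq> \<Lambda>" ..
    then have e: "\<And>\<alpha>. inj_on (e \<alpha>) {X \<in> \<F>. \<alpha> \<in> B X}"
        "\<And>\<alpha> X. X \<in> \<F> \<Longrightarrow> \<alpha> \<in> B X \<Longrightarrow> e \<alpha> X \<in> \<Lambda>"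
      by auto
    have "\<forall>X\<in>\<F>. \<exists>\<xi>. \<xi> \<in> \<Lambda> \<and> {\<alpha> \<in> B X. e \<alpha> X = \<xi>} \<notin> J"
    proof (rule ballI, rule ccontr)
      fix X assume "X \<in> \<F>" "\<not> (\<exists>\<xi>. \<xi> \<in> \<Lambda> \<and> {\<alpha> \<in> B X. e \<alpha> X = \<xi>} \<notin> J)"
      then have "(\<Union>\<xi>\<in>\<Lambda>. {\<alpha> \<in> B X. e \<alpha> X = \<xi>}) \<in> J"
        by (intro J.UN_mem ordLeq_refl card_of_Card_order) auto
      moreover have "B X \<subseteq> (\<Union>\<xi>\<in>\<Lambda>. {\<alpha> \<in> B X. e \<alpha> X = \<xi>})" using e(2)[OF \<open>X \<in> \<F>\<close>] by auto
      ultimately show False using B[OF \<open>X \<in> \<F>\<close>] J.subset_mem by blast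
    qed
    from bchoice[OF this] obtain \<xi>
      where "\<forall>X\<in>\<F>. \<xi> X \<in> \<Lambda> \<and> {\<alpha> \<in> B X. e \<alpha> X = \<xi> X} \<notin> J" ..
    then have \<xi>: "\<And>X. X \<in> \<F> \<Longrightarrow> \<xi> X \<in> \<Lambda>"
        "\<And>X. X \<in> \<F> \<Longrightarrow> {\<alpha> \<in> B X. e \<alpha> X = \<xi> X} \<notin> J" by auto
    let ?g = "\<lambda>X. {\<alpha> \<in> B X. e \<alpha> X = \<xi> X}"
    \<comment> \<open>Members with the same place \<open>x\<close> have disjoint sets
      \<open>?g X\<close>, because \<open>e \<alpha>\<close> is injective. So there are at most
      \<open>|\<Lambda>|\<close> of them for each of the \<open>|\<Lambda>|\<close> places.\<close>
    have "|{X \<in> \<F>. \<xi> X = x}| \<le>o |\<Lambda>|" for x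
    proof -
      have dis': "disjnt (?g X) (?g Y)"
        if "X \<in> {X \<in> \<F>. \<xi> X = x}" "Y \<in> {X \<in> \<F>. \<xi> X = x}" "X \<noteq> Y" for X Y
      proof (unfold disjnt_iff, intro allI notI, elim conjE)
        fix \<alpha> assume "\<alpha> \<in> ?g X" "\<alpha> \<in> ?g Y"
        then show False using inj_onD[OF e(1)[of \<alpha>], of X Y] that by simp
      qed
      have ne: "?g X \<noteq> {}" if "X \<in> \<F>" for X
        using \<xi>(2)[OF that] J.empty_mem by metis
      have "inj_on ?g {X \<in> \<F>. \<xi> X = x}"
      proof (rule inj_onI, rule ccontr)
        fix X Y assume XY: "X \<in> {X \<in> \<F>. \<xi> X = x}" "Y \<in> {X \<in> \<F>. \<xi> X = x}" "?g X = ?g Y" "X \<noteq> Y"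
        have "?g X = {}" using dis'[OF XY(1,2,4)] XY(3) by (metis disjnt_self_iff_empty)
        with ne XY(1) show False by blast
      qed
      then have "|{X \<in> \<F>. \<xi> X = x}| =o |?g ` {X \<in> \<F>. \<xi> X = x}|"
        by (rule card_of_ordIsoI[OF inj_on_imp_bij_betw])
      moreover have "|?g ` {X \<in> \<F>. \<xi> X = x}| \<le>o |\<Lambda>|"
      proof (rule J.card_disjoint_positive)
        show "pairwise disjnt (?g ` {X \<in> \<F>. \<xi> X = x})"
          using dis' unfolding pairwise_def by blast
        show "?g ` {X \<in> \<F>. \<xi> X = x} \<inter> J = {}" using \<xi>(2) by blast
      qed
      ultimately show ?thesis by (rule ordIso_ordLeq_trans)
    qed
    then have "|\<Union>x\<in>\<Lambda>. {X \<in> \<F>. \<xi> X = x}| \<le>o |\<Lambda>|"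
      using J.infinite_bound by (intro card_of_UNION_ordLeq_infinite) (auto intro: ordLeq_refl card_of_Card_order)
    moreover have "\<F> = (\<Union>x\<in>\<Lambda>. {X \<in> \<F>. \<xi> X = x})" using \<xi>(1) by auto
    ultimately show "|\<F>| \<le>o |\<Lambda>|" by simp
  qed
qed

section \<open>Tuples from a set in the dual filter\<close>

text \<open>This is used to keep a set positive when its tuples are restricted to \<open>H\<close>.
  The fiber over a point of \<open>H\<close> is the same set for lists that are shorter by
  one.\<close>

lemma fubini_null_not_subset:
  assumes "complete_saturated_ideal J \<Lambda>" "- H \<in> J"
  shows "{a. \<not> set a \<subseteq> H} \<in> fubini_null J n"
proof (induction n)
  case (Suc n)
  have "Cons \<alpha> -` {a. \<not> set a \<subseteq> H} \<in> fubini_null J n" if "\<alpha> \<in> H" for \<alpha>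
    using Suc that by simp
  then have "{\<alpha>. Cons \<alpha> -` {a. \<not> set a \<subseteq> H} \<notin> fubini_null J n} \<subseteq> - H" by blast
  then show ?case using complete_saturated_ideal.subset_mem[OF assms] by simp
qed simp

text \<open>Here normality turns almost all tuples into all tuples. By induction each good first
  coordinate \<open>\<alpha>\<close> has its own set \<open>H \<alpha>\<close> for the remaining
  coordinates. The diagonal intersection of these sets works for all \<open>\<alpha>\<close> at
  once, since the later coordinates of a tuple exceed \<open>\<alpha>\<close>.\<close>

lemma diagonal_homogeneous:
  assumes J: "complete_saturated_ideal J \<Lambda>" and "normal_ideal J"
    and "tuples M - Z \<in> fubini_null J M"
  shows "\<exists>H. - H \<in> J \<and> (\<forall>c\<in>tuples M. set c \<subseteq> H \<longrightarrow> c \<in> Z)"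
  using assms(3)
proof (induction M arbitrary: Z)
  case 0
  then show ?case
    using complete_saturated_ideal.empty_mem[OF J] by (intro exI[of _ UNIV]) (auto simp: tuples_def)
next
  case (Suc M)
  define G where "G = {\<alpha>. Cons \<alpha> -` (tuples (Suc M) - Z) \<in> fubini_null J M}"
  have "- G \<in> J" using Suc.prems by (simp add: G_def Collect_neg_eq)
  have "\<exists>H. - H \<in> J \<and> (\<forall>c\<in>tuples M. set c \<subseteq> H \<longrightarrow> (\<forall>x\<in>set c. \<alpha> < x) \<longrightarrow> \<alpha> # c \<in> Z)"
    if "\<alpha> \<in> G" for \<alpha>
  proof -
    \<comment> \<open>The guard excludes those \<open>c\<close> with an entry not above
      \<open>\<alpha>\<close>, for which \<open>\<alpha> # c\<close> is not increasing and the fiber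
      says nothing.\<close>
    have "tuples M - {c. (\<forall>x\<in>set c. \<alpha> < x) \<longrightarrow> \<alpha> # c \<in> Z} \<subseteq> Cons \<alpha> -` (tuples (Suc M) - Z)"
      by (auto simp: tuples_def)
    then have "tuples M - {c. (\<forall>x\<in>set c. \<alpha> < x) \<longrightarrow> \<alpha> # c \<in> Z} \<in> fubini_null J M"
      using that complete_saturated_ideal.subset_mem[OF fubini_null_complete_saturated[OF J]]
      unfolding G_def by blast
    from Suc.IH[OF this] show ?thesis by auto
  qed
  then obtain H where H: "\<And>\<alpha>. \<alpha> \<in> G \<Longrightarrow> - H \<alpha> \<in> J"
      "\<And>\<alpha> c. \<alpha> \<in> G \<Longrightarrow> c \<in> tuples M \<Longrightarrow> set c \<subseteq> H \<alpha> \<Longrightarrow> \<forall>x\<in>set c. \<alpha> < x \<Longrightarrow> \<alpha> # c \<in> Z"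
    by metis
  define K where "K = {\<beta> \<in> G. \<forall>\<alpha><\<beta>. \<alpha> \<in> G \<longrightarrow> \<beta> \<in> H \<alpha>}"
  have "\<forall>\<alpha>. (if \<alpha> \<in> G then - H \<alpha> else {}) \<in> J"
    using H(1) complete_saturated_ideal.empty_mem[OF J] by auto
  then have "{\<beta>. \<exists>\<alpha><\<beta>. \<beta> \<in> (if \<alpha> \<in> G then - H \<alpha> else {})} \<in> J"
    using \<open>normal_ideal J\<close>[unfolded normal_ideal_def, rule_format,
        of "\<lambda>\<alpha>. if \<alpha> \<in> G then - H \<alpha> else {}"] by blast
  then have "{\<beta>. \<exists>\<alpha><\<beta>. \<beta> \<in> (if \<alpha> \<in> G then - H \<alpha> else {})} \<union> - G \<in> J"
    using \<open>- G \<in> J\<close> by (rule complete_saturated_ideal.Un_mem[OF J])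
  then have "- K \<in> J"
    by (rule complete_saturated_ideal.subset_mem[OF J]) (auto simp: K_def)
  moreover have "c \<in> Z" if "c \<in> tuples (Suc M)" "set c \<subseteq> K" for c
  proof -
    obtain \<alpha> c' where c: "c = \<alpha> # c'" using \<open>c \<in> tuples (Suc M)\<close> by (cases c) (auto simp: tuples_def)
    show ?thesis unfolding c
      by (rule H(2)) (use that in \<open>auto simp: c tuples_def K_def\<close>)
  qed
  ultimately show ?case by blast
qed

section \<open>Merging tuples\<close>

lemma nths_eq_iff:
  assumes "length c = length c'"
  shows "nths c S = nths c' S \<longleftrightarrow> (\<forall>i<length c. i \<in> S \<longrightarrow> c ! i = c' ! i)"
  using assms
proof (induction c c' arbitrary: S rule: list_induct2)
  case (Cons x c y c')
  show ?case
    using Cons.IH[of "{j. Suc j \<in> S}"] by (auto simp: nths_Cons All_less_Suc2)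
qed simp

text \<open>Hulls are indexed by positions within an \<open>m\<close>-tuple, while merging works
  with positions in the merged tuple. The ranks translate positions of the second kind, in
  \<open>A \<inter> T\<close>, into positions within the subtuple \<open>nths c A\<close>.\<close>

definition ranks :: "nat set \<Rightarrow> nat set \<Rightarrow> nat set" where
  "ranks A T = (\<lambda>i. card {i' \<in> A. i' < i}) ` (A \<inter> T)"

lemma inj_on_rank: "finite A \<Longrightarrow> inj_on (\<lambda>i. card {i' \<in> A. i' < i}) (A :: nat set)"
proof (rule linorder_inj_onI')
  fix i j assume "finite A" "i \<in> A" "j \<in> A" "i < j"
  then have "card {i' \<in> A. i' < i} < card {i' \<in> A. i' < j}"
    by (intro psubset_card_mono) auto
  then show "card {i' \<in> A. i' < i} \<noteq> card {i' \<in> A. i' < j}" by simp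
qed

lemma nths_nths_ranks:
  assumes "finite A"
  shows "nths (nths c A) (ranks A T) = nths c (A \<inter> T)"
proof -
  have "{i \<in> A. \<exists>j\<in>ranks A T. card {i' \<in> A. i' < i} = j} = A \<inter> T"
  proof (intro equalityI subsetI)
    fix i assume "i \<in> {i \<in> A. \<exists>j\<in>ranks A T. card {i' \<in> A. i' < i} = j}"
    then obtain k where k: "i \<in> A" "k \<in> A \<inter> T" "card {i' \<in> A. i' < i} = card {i' \<in> A. i' < k}"
      by (auto simp: ranks_def)
    have "i = k" by (rule inj_onD[OF inj_on_rank[OF assms] k(3,1)]) (use k(2) in blast)
    with k(2) show "i \<in> A \<inter> T" by simp
  qed (auto simp: ranks_def)
  then show ?thesis by (simp only: nths_nths)
qed

lemma ranks_subset: "finite A \<Longrightarrow> ranks A T \<subseteq> {..<card A}"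
  by (auto simp: ranks_def intro!: psubset_card_mono)

text \<open>The coordinates outside \<open>A\<close> can be thinned out to functions of the preceding
  coordinates in \<open>A\<close>.\<close>

lemma uniformization:
  assumes J: "complete_saturated_ideal J \<Lambda>"
    and "W \<notin> fubini_null J M"
  shows "\<exists>V\<subseteq>W. (\<lambda>c. nths c A) ` V \<notin> fubini_null J (card (A \<inter> {..<M})) \<and>
    (\<forall>c\<in>V. \<forall>c'\<in>V. \<forall>j\<le>M. (\<forall>i<j. i \<in> A \<longrightarrow> c ! i = c' ! i) \<longrightarrow> take j c = take j c')"
  using \<open>W \<notin> fubini_null J M\<close>
proof (induction M arbitrary: A W)
  case 0
  then show ?case by (intro exI[of _ "{[]}"]) auto
next
  case (Suc M)
  interpret J: complete_saturated_ideal J \<Lambda> by (rule J)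
  \<comment> \<open>The first coordinate is split off, so the remaining positions of
    \<open>A\<close> move down by one.\<close>
  let ?A = "{j. Suc j \<in> A}"
  let ?B = "{x. Cons x -` W \<notin> fubini_null J M}"
  let ?P = "\<lambda>x V. V \<subseteq> Cons x -` W \<and> (\<lambda>c. nths c ?A) ` V \<notin> fubini_null J (card (?A \<inter> {..<M})) \<and>
      (\<forall>c\<in>V. \<forall>c'\<in>V. \<forall>j\<le>M. (\<forall>i<j. i \<in> ?A \<longrightarrow> c ! i = c' ! i) \<longrightarrow> take j c = take j c')"
  have "\<forall>x\<in>?B. \<exists>V. ?P x V"
  proof
    fix x assume "x \<in> ?B"
    then show "\<exists>V. ?P x V" by (intro Suc.IH) simp
  qed
  from bchoice[OF this] obtain V where PV: "\<forall>x\<in>?B. ?P x (V x)" ..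
  note V = conjunct1[OF bspec[OF PV]] conjunct1[OF conjunct2[OF bspec[OF PV]]]
    conjunct2[OF conjunct2[OF bspec[OF PV]]]
  have B: "?B \<notin> J" using Suc.prems by simp
  have det: "take j (x # c) = take j (x # c')"
    if "x \<in> ?B" "c \<in> V x" "c' \<in> V x" "j \<le> Suc M"
      and agree: "\<forall>i<j. i \<in> A \<longrightarrow> (x # c) ! i = (x # c') ! i" for x c c' j
  proof (cases j)
    case (Suc j')
    have "\<forall>i<j'. i \<in> ?A \<longrightarrow> c ! i = c' ! i"
      using agree[rule_format, of "Suc i" for i] Suc by auto
    then have "take j' c = take j' c'"
      using that(4) Suc by (intro V(3)[OF that(1), rule_format, OF that(2,3)]) auto
    then show ?thesis using Suc by simp
  qed simp
  have Suc_image: "A \<inter> {..<Suc M} - {0} = Suc ` (?A \<inter> {..<M})"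
  proof
    show "A \<inter> {..<Suc M} - {0} \<subseteq> Suc ` (?A \<inter> {..<M})"
    proof
      fix i assume "i \<in> A \<inter> {..<Suc M} - {0}"
      then show "i \<in> Suc ` (?A \<inter> {..<M})" by (cases i) auto
    qed
  qed auto
  have card_eq: "card (A \<inter> {..<Suc M} - {0}) = card (?A \<inter> {..<M})"
    unfolding Suc_image by (simp add: card_image)
  show ?case
  proof (cases "0 \<in> A")
    case False
    have "?B \<noteq> {}" using B J.empty_mem by metis
    \<comment> \<open>A first coordinate outside \<open>A\<close> has nothing before it and must
      become constant. The projection to \<open>A\<close> does not see it, so one positive fiber
      suffices.\<close>
    then obtain x where x: "x \<in> ?B" by blast
    have *: "card (A \<inter> {..<Suc M}) = card (?A \<inter> {..<M})" using False card_eq by simp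
    show ?thesis
    proof (intro exI[of _ "Cons x ` V x"] conjI ballI allI impI)
      show "Cons x ` V x \<subseteq> W" using V(1)[OF x] by auto
      show "(\<lambda>c. nths c A) ` Cons x ` V x \<notin> fubini_null J (card (A \<inter> {..<Suc M}))"
        using V(2)[OF x] False unfolding * by (simp add: image_image nths_Cons)
    next
      fix c c' j
      assume c: "c \<in> Cons x ` V x" "c' \<in> Cons x ` V x" "j \<le> Suc M"
        "\<forall>i<j. i \<in> A \<longrightarrow> c ! i = c' ! i"
      then obtain d d' where d: "d \<in> V x" "d' \<in> V x" "c = x # d" "c' = x # d'" by blast
      show "take j c = take j c'"
        unfolding d(3,4) by (rule det[OF x d(1,2) c(3) c(4)[unfolded d(3,4)]])
    qed
  next
    case True
    then have "Suc (card (A \<inter> {..<Suc M} - {0})) = card (A \<inter> {..<Suc M})"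
      by (intro card_Suc_Diff1) auto
    then have *: "card (A \<inter> {..<Suc M}) = Suc (card (?A \<inter> {..<M}))"
      by (simp only: card_eq)
    \<comment> \<open>A first coordinate in \<open>A\<close> keeps all its values with a positive
      fiber, because tuples agreeing on \<open>A\<close> then share that value.\<close>
    let ?V = "\<Union>x\<in>?B. Cons x ` V x"
    show ?thesis
    proof (intro exI[of _ ?V] conjI ballI allI impI)
      show "?V \<subseteq> W" using V(1) by auto
      have sub: "(\<lambda>c. nths c ?A) ` V x \<subseteq> Cons x -` ((\<lambda>c. nths c A) ` ?V)" if "x \<in> ?B" for x
      proof
        fix a assume "a \<in> (\<lambda>c. nths c ?A) ` V x"
        then obtain c where c: "c \<in> V x" "a = nths c ?A" by auto
        then have m: "x # c \<in> ?V" "x # a = nths (x # c) A"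
          using that True by (auto simp: nths_Cons)
        then show "a \<in> Cons x -` ((\<lambda>c. nths c A) ` ?V)" by (intro vimageI2 image_eqI[where x = "x # c"]) (rule m(2), rule m(1))
      qed
      have "Cons x -` ((\<lambda>c. nths c A) ` ?V) \<notin> fubini_null J (card (?A \<inter> {..<M}))" if "x \<in> ?B" for x
      proof
        assume "Cons x -` ((\<lambda>c. nths c A) ` ?V) \<in> fubini_null J (card (?A \<inter> {..<M}))"
        then have "(\<lambda>c. nths c ?A) ` V x \<in> fubini_null J (card (?A \<inter> {..<M}))"
          by (rule complete_saturated_ideal.subset_mem[OF fubini_null_complete_saturated[OF J]])
            (rule sub[OF that])
        with V(2)[OF that] show False by contradiction
      qed
      then have "?B \<subseteq> {x. Cons x -` ((\<lambda>c. nths c A) ` ?V) \<notin> fubini_null J (card (?A \<inter> {..<M}))}"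
        by (intro subsetI CollectI)
      from B J.subset_mem[OF _ this]
      show "(\<lambda>c. nths c A) ` ?V \<notin> fubini_null J (card (A \<inter> {..<Suc M}))"
        unfolding * fubini_null.simps(2) mem_Collect_eq by blast
    next
      fix c c' j
      assume c: "c \<in> ?V" "c' \<in> ?V" "j \<le> Suc M" "\<forall>i<j. i \<in> A \<longrightarrow> c ! i = c' ! i"
      show "take j c = take j c'"
      proof (cases "j = 0")
        case False
        obtain x d y d' where d: "x \<in> ?B" "d \<in> V x" "d' \<in> V y" "c = x # d" "c' = y # d'"
          using c(1,2) by blast
        have "x = y" using c(4)[rule_format, of 0] True False d(4,5) by simp
        with d have d': "d' \<in> V x" "c' = x # d'" by auto
        show ?thesis
          unfolding d(4) d'(2) by (rule det[OF d(1,2) d'(1) c(3) c(4)[unfolded d(4) d'(2)]])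
      qed simp
    qed
  qed
qed

section \<open>Noetherian relations\<close>

definition perp :: "('p \<Rightarrow> 'p \<Rightarrow> bool) \<Rightarrow> 'p set \<Rightarrow> 'p set \<Rightarrow> 'p set" where
  "perp R Q T = {q \<in> Q. \<forall>t\<in>T. \<not> R t q}"

definition half_graph_free :: "('p \<Rightarrow> 'p \<Rightarrow> bool) \<Rightarrow> 'p set \<Rightarrow> bool" where
  "half_graph_free R Q \<longleftrightarrow>
     (\<forall>u v :: nat \<Rightarrow> 'p. (\<forall>i. u i \<in> Q \<and> v i \<in> Q \<and> R (u i) (v i)) \<longrightarrow> (\<exists>i j. i < j \<and> R (u i) (v j)))"

text \<open>Each strict drop yields \<open>v\<close> in \<open>f i\<close> but not in
  \<open>f (Suc i)\<close>, and hence some \<open>t\<close> that is related to \<open>v\<close> and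
  to nothing in \<open>f (Suc i)\<close>. Later choices of \<open>v\<close> lie in
  \<open>f (Suc i)\<close>, so these pairs would form a half graph.\<close>

lemma no_descending_chain_of_perps:
  fixes f :: "nat \<Rightarrow> 'p set"
  assumes "half_graph_free R Q"
  shows "\<exists>i. \<not> (f (Suc i) \<in> perp R Q ` Pow Q \<and> f i \<in> perp R Q ` Pow Q \<and> f (Suc i) \<subset> f i)"
proof (rule ccontr)
  assume "\<not> ?thesis"
  then have f: "f i \<in> perp R Q ` Pow Q" "f (Suc i) \<subset> f i" for i by blast+
  have "\<forall>i. \<exists>tv. fst tv \<in> Q \<and> snd tv \<in> Q \<and> R (fst tv) (snd tv) \<and> snd tv \<in> f i \<and>
      (\<forall>w\<in>f (Suc i). \<not> R (fst tv) w)"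
  proof
    fix i
    obtain S where S: "S \<subseteq> Q" "f i = perp R Q S" using f(1)[of i] by blast
    obtain T where T: "T \<subseteq> Q" "f (Suc i) = perp R Q T" using f(1)[of "Suc i"] by blast
    obtain v where v: "v \<in> f i" "v \<notin> f (Suc i)" using f(2)[of i] by blast
    have "v \<in> Q" using v S by (simp add: perp_def)
    with v(2) T obtain t where "t \<in> T" "R t v" by (auto simp: perp_def)
    with T v \<open>v \<in> Q\<close> show "\<exists>tv. fst tv \<in> Q \<and> snd tv \<in> Q \<and> R (fst tv) (snd tv) \<and> snd tv \<in> f i \<and>
      (\<forall>w\<in>f (Suc i). \<not> R (fst tv) w)"
      by (intro exI[of _ "(t, v)"]) (auto simp: perp_def)
  qed
  from choice[OF this] obtain tv where tv: "\<forall>i. fst (tv i) \<in> Q \<and> snd (tv i) \<in> Q \<and>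
      R (fst (tv i)) (snd (tv i)) \<and> snd (tv i) \<in> f i \<and> (\<forall>w\<in>f (Suc i). \<not> R (fst (tv i)) w)" ..
  then obtain i j where ij: "i < j" "R (fst (tv i)) (snd (tv j))"
    using assms[unfolded half_graph_free_def, rule_format, of "\<lambda>i. fst (tv i)" "\<lambda>i. snd (tv i)"]
    by blast
  have "f j \<subseteq> f (Suc i)"
    by (rule lift_Suc_antimono_le) (use f(2) ij(1) in auto)
  with tv ij(2) show False by blast
qed

section \<open>Essential hulls\<close>

text \<open>The value \<open>\<pi> a\<close> is the part of \<open>a\<close> on which the hull may
  depend. The last clause is minimality, tested by functions \<open>S\<close> of the same part: for
  almost all \<open>a\<close>, if some element of \<open>S (\<pi> a)\<close> is related to an
  element of \<open>D (\<pi> a)\<close>, then some element of \<open>S (\<pi> a)\<close> is related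
  to \<open>p a\<close> itself.\<close>

definition essential_hull ::
  "'a set set \<Rightarrow> ('p \<Rightarrow> 'p \<Rightarrow> bool) \<Rightarrow> 'p set \<Rightarrow> ('a \<Rightarrow> 'p) \<Rightarrow> ('a \<Rightarrow> 'e) \<Rightarrow> 'a set \<Rightarrow> ('e \<Rightarrow> 'p set) \<Rightarrow> bool"
where
  "essential_hull N R Q p \<pi> X D \<longleftrightarrow>
     (\<forall>a\<in>X. p a \<in> D (\<pi> a)) \<and> (\<forall>e. D e \<subseteq> Q) \<and>
     (\<forall>S. (\<forall>e. S e \<subseteq> Q) \<longrightarrow>
        {a \<in> X. p a \<in> perp R Q (S (\<pi> a)) \<and> \<not> D (\<pi> a) \<subseteq> perp R Q (S (\<pi> a))} \<in> N)"

lemma (in complete_saturated_ideal) essential_hull_subset: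
  assumes "essential_hull N R Q p \<pi> X D" "X' \<subseteq> X"
  shows "essential_hull N R Q p \<pi> X' D"
  unfolding essential_hull_def
proof (intro conjI allI impI)
  show "\<forall>a\<in>X'. p a \<in> D (\<pi> a)" "D e \<subseteq> Q" for e
    using assms by (auto simp: essential_hull_def)
  fix S :: "'c \<Rightarrow> 'b set" assume S: "\<forall>e. S e \<subseteq> Q"
  have "{a \<in> X. p a \<in> perp R Q (S (\<pi> a)) \<and> \<not> D (\<pi> a) \<subseteq> perp R Q (S (\<pi> a))} \<in> N"
    using assms(1) S by (simp add: essential_hull_def)
  then show "{a \<in> X'. p a \<in> perp R Q (S (\<pi> a)) \<and> \<not> D (\<pi> a) \<subseteq> perp R Q (S (\<pi> a))} \<in> N"
    by (rule subset_mem) (use assms(2) in blast)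
qed

text \<open>Sets of the form \<open>perp R Q T\<close> admit no infinite descent, so
  \<open>minimal_function\<close> applies to them. A test function \<open>S\<close> violating
  minimality would allow \<open>D e\<close> to be lowered to
  \<open>D e \<inter> perp R Q (S e)\<close>, which is again of this form.\<close>

lemma (in complete_saturated_ideal) essential_hull_exists:
  fixes \<pi> :: "'a \<Rightarrow> 'e"
  assumes "half_graph_free R Q" "X \<notin> N" "\<forall>a\<in>X. p a \<in> Q"
  shows "\<exists>X'\<subseteq>X. X' \<notin> N \<and> (\<exists>D. essential_hull N R Q p \<pi> X' D)"
proof -
  let ?L = "perp R Q ` Pow Q"
  let ?lt = "\<lambda>C D. C \<in> ?L \<and> D \<in> ?L \<and> C \<subset> D" and ?G = "\<lambda>a C. C \<in> ?L \<and> p a \<in> C"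
  have "Q = perp R Q {}" by (auto simp: perp_def)
  then have "Q \<in> ?L" by blast
  then have top: "?G a Q" if "a \<in> X" for a using assms(3) that by simp
  obtain X' D where X': "X' \<subseteq> X" "X' \<notin> N" "\<And>a. a \<in> X' \<Longrightarrow> ?G a (D (\<pi> a))"
    and min: "\<And>F. {a \<in> X'. ?G a (F (\<pi> a)) \<and> ?lt (F (\<pi> a)) (D (\<pi> a))} \<in> N"
    by (rule minimal_function[where lt = ?lt and G = ?G and \<pi> = \<pi> and t = Q, OF
        no_descending_chain_of_perps[OF assms(1)] assms(2) top]) (assumption, rule that)
  have L_Int: "C \<inter> perp R Q T \<in> ?L" if "C \<in> ?L" "T \<subseteq> Q" for C T
  proof -
    from that(1) obtain S where S: "C = perp R Q S" "S \<in> Pow Q" by (rule imageE)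
    have "C \<inter> perp R Q T = perp R Q (S \<union> T)" unfolding S(1) by (auto simp: perp_def)
    moreover have "S \<union> T \<in> Pow Q" using S(2) that(2) by simp
    ultimately show ?thesis by (rule image_eqI)
  qed
  \<comment> \<open>Off the image of \<open>X'\<close> nothing is known about \<open>D e\<close>.
    Intersecting with \<open>Q\<close> secures the clause that concerns all
    \<open>e\<close>.\<close>
  have "essential_hull N R Q p \<pi> X' (\<lambda>e. D e \<inter> Q)"
    unfolding essential_hull_def
  proof (intro conjI allI impI ballI)
    fix a assume "a \<in> X'"
    then show "p a \<in> D (\<pi> a) \<inter> Q" using X' assms(3) by blast
  next
    fix S :: "'e \<Rightarrow> 'b set" assume S: "\<forall>e. S e \<subseteq> Q"
    let ?F = "\<lambda>e. D e \<inter> perp R Q (S e)"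
    show "{a \<in> X'. p a \<in> perp R Q (S (\<pi> a)) \<and> \<not> D (\<pi> a) \<inter> Q \<subseteq> perp R Q (S (\<pi> a))} \<in> N"
    proof (rule subset_mem[OF min[of ?F]], rule subsetI, elim CollectE conjE, intro CollectI conjI)
      fix a assume a: "a \<in> X'" "p a \<in> perp R Q (S (\<pi> a))" "\<not> D (\<pi> a) \<inter> Q \<subseteq> perp R Q (S (\<pi> a))"
      show "a \<in> X'" by fact
      show "D (\<pi> a) \<in> ?L" using X'(3)[OF a(1)] by blast
      then show "?F (\<pi> a) \<in> ?L" "?F (\<pi> a) \<in> ?L" using L_Int S by blast+
      show "p a \<in> ?F (\<pi> a)" using X'(3)[OF a(1)] a(2) by blast
      show "?F (\<pi> a) \<subset> D (\<pi> a)" using a(3) by blast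
    qed
  qed blast
  with X' show ?thesis by blast
qed

text \<open>A hull remains a hull on a smaller set, so finitely many projections can be treated one
  after another.\<close>

lemma (in complete_saturated_ideal) essential_hulls_exist:
  fixes \<pi> :: "'i \<Rightarrow> 'a \<Rightarrow> 'e"
  assumes "finite I" "half_graph_free R Q" "X \<notin> N" "\<forall>a\<in>X. p a \<in> Q"
  shows "\<exists>X'\<subseteq>X. X' \<notin> N \<and> (\<exists>D. \<forall>i\<in>I. essential_hull N R Q p (\<pi> i) X' (D i))"
proof -
  have "\<exists>X'\<subseteq>X. X' \<notin> N \<and> (\<forall>i\<in>I. \<exists>D. essential_hull N R Q p (\<pi> i) X' D)"
    using assms(1)
  proof (induction I)
    case empty
    then show ?case using assms(3) by blast
  next
    case (insert i I)
    then obtain X1 where X1: "X1 \<subseteq> X" "X1 \<notin> N" "\<forall>i\<in>I. \<exists>D. essential_hull N R Q p (\<pi> i) X1 D"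
      by blast
    have "\<forall>a\<in>X1. p a \<in> Q" using X1(1) assms(4) by blast
    from essential_hull_exists[OF assms(2) X1(2) this, of "\<pi> i"] obtain X2
      where X2: "X2 \<subseteq> X1" "X2 \<notin> N" "\<exists>D. essential_hull N R Q p (\<pi> i) X2 D" by blast
    have "\<exists>D. essential_hull N R Q p (\<pi> k) X2 D" if "k \<in> I" for k
    proof -
      obtain D where "essential_hull N R Q p (\<pi> k) X1 D" using X1(3) \<open>k \<in> I\<close> by blast
      from essential_hull_subset[OF this X2(1)] show ?thesis by (intro exI[of _ D])
    qed
    with X1(1) X2 show ?case by (intro exI[of _ X2]) auto
  qed
  then obtain X' where "X' \<subseteq> X" "X' \<notin> N" "\<forall>i\<in>I. \<exists>D. essential_hull N R Q p (\<pi> i) X' D" by blast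
  with bchoice[OF this(3)] show ?thesis by (intro exI[of _ X'] conjI) simp_all
qed

section \<open>Types of pairs of tuples\<close>

definition related :: "('p \<Rightarrow> 'p \<Rightarrow> bool) \<Rightarrow> 'p set \<Rightarrow> 'p set \<Rightarrow> bool" where
  "related R C E \<longleftrightarrow> (\<exists>x\<in>C. \<exists>y\<in>E. R x y)"

lemma related_sym: "(\<And>x y. R x y \<Longrightarrow> R y x) \<Longrightarrow> related R C E \<Longrightarrow> related R E C"
  unfolding related_def by blast

lemma subset_perp_iff:
  assumes "\<And>x y. R x y \<Longrightarrow> R y x" "C \<subseteq> Q"
  shows "C \<subseteq> perp R Q E \<longleftrightarrow> \<not> related R C E"
proof
  assume sub: "C \<subseteq> perp R Q E"
  show "\<not> related R C E"
  proof
    assume "related R C E"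
    then obtain x y where "x \<in> C" "y \<in> E" "R x y" unfolding related_def by blast
    with sub assms(1)[of x y] show False unfolding perp_def by blast
  qed
next
  assume not: "\<not> related R C E"
  show "C \<subseteq> perp R Q E"
    using not assms(1)[of y x for x y] assms(2) unfolding related_def perp_def by auto
qed

lemma ranks_cong: "A \<inter> T = A \<inter> T' \<Longrightarrow> ranks A T = ranks A T'"
  by (simp add: ranks_def)

text \<open>Here \<open>E c\<close> depends only on the coordinates below \<open>j\<close> and the common coordinates, so that after
  uniformization it is a function of the part of the tuple on which the hull \<open>D\<close> depends.\<close>

lemma merge_step:
  fixes D :: "'k list \<Rightarrow> 'p set"
  assumes J: "complete_saturated_ideal J \<Lambda>" and sym: "\<And>x y. R x y \<Longrightarrow> R y x"
    and A: "A \<subseteq> {..<M}" "card A = m" and j: "j \<le> M" and p: "\<forall>a\<in>X. p a \<in> Q"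
    and hull: "essential_hull (fubini_null J m) R Q p (\<lambda>a. nths a (ranks A (B \<union> {..<j}))) X D"
    and E: "\<And>c. E c \<subseteq> Q"
    and det: "\<And>c c'. length c = M \<Longrightarrow> length c' = M \<Longrightarrow>
      \<forall>i<M. i < j \<or> i \<in> A \<inter> B \<longrightarrow> c ! i = c' ! i \<Longrightarrow> E c = E c'"
  shows "{c. length c = M \<and> nths c A \<in> X \<and> related R (D (nths c (A \<inter> (B \<union> {..<j})))) (E c) \<and>
    \<not> related R {p (nths c A)} (E c)} \<in> fubini_null J M" (is "?W \<in> _")
proof (rule ccontr)
  assume "?W \<notin> fubini_null J M"
  \<comment> \<open>On \<open>V\<close> the coordinates in \<open>A\<close> below \<open>j\<close>
    determine all coordinates below \<open>j\<close>, while the projection of \<open>V\<close> to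
    \<open>A\<close> stays positive.\<close>
  from uniformization[OF J this, of A] obtain V where V: "V \<subseteq> ?W"
    "(\<lambda>c. nths c A) ` V \<notin> fubini_null J (card (A \<inter> {..<M}))"
    and V_det: "\<forall>c\<in>V. \<forall>c'\<in>V. \<forall>j\<le>M. (\<forall>i<j. i \<in> A \<longrightarrow> c ! i = c' ! i) \<longrightarrow> take j c = take j c'"
    by (elim exE conjE)
  have finA: "finite A" using A(1) finite_subset by blast
  have card: "card (A \<inter> {..<M}) = m" using A by (simp add: Int_absorb2)
  let ?T = "B \<union> {..<j}"
  let ?e = "\<lambda>c. nths c (A \<inter> ?T)"
  \<comment> \<open>The test function takes the value of \<open>E\<close> at any representative in
    \<open>V\<close>; \<open>S_eq\<close> shows that the choice does not matter.\<close>
  define S where "S e = E (SOME c. c \<in> V \<and> ?e c = e)" for e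
  have len: "length c = M" if "c \<in> V" for c using V(1) that by blast
  have S_eq: "S (?e c) = E c" if c: "c \<in> V" for c
  proof -
    define c' where "c' = (SOME d. d \<in> V \<and> ?e d = ?e c)"
    have "c' \<in> V \<and> ?e c' = ?e c"
      unfolding c'_def by (rule someI[of _ c]) (simp add: c)
    then have c': "c' \<in> V" "?e c' = ?e c" by auto
    have agree: "c' ! i = c ! i" if "i < M" "i \<in> A \<inter> ?T" for i
      using c'(2) that len[OF c] len[OF c'(1)] nths_eq_iff[of c' c "A \<inter> ?T"] by simp
    have "take j c' = take j c"
      using V_det[rule_format, OF c'(1) c j] agree j by simp
    then have "c' ! i = c ! i" if "i < j" for i
      using that by (metis nth_take)
    then have "\<forall>i<M. i < j \<or> i \<in> A \<inter> B \<longrightarrow> c' ! i = c ! i" using agree by blast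
    from det[OF len[OF c'(1)] len[OF c] this] show ?thesis
      unfolding S_def c'_def .
  qed
  have SQ: "\<forall>e. S e \<subseteq> Q" unfolding S_def using E by blast
  let ?r = "ranks A ?T"
  \<comment> \<open>Minimality of the hull against \<open>S\<close> makes this set null, but it
    contains the positive projection of \<open>V\<close>.\<close>
  let ?Z = "{a \<in> X. p a \<in> perp R Q (S (nths a ?r)) \<and> \<not> D (nths a ?r) \<subseteq> perp R Q (S (nths a ?r))}"
  have DQ: "D e \<subseteq> Q" for e using hull by (simp add: essential_hull_def)
  have Z: "?Z \<in> fubini_null J m" using hull SQ by (simp add: essential_hull_def)
  have "(\<lambda>c. nths c A) ` V \<subseteq> ?Z"
  proof (rule image_subsetI)
    fix c assume c: "c \<in> V"
    let ?a = "nths c A"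
    have a: "nths ?a ?r = ?e c" by (rule nths_nths_ranks[OF finA])
    have W: "?a \<in> X" "related R (D (?e c)) (E c)" "\<not> related R {p ?a} (E c)" using V(1) c by blast+
    have "p ?a \<in> Q" using p W(1) by blast
    then have "p ?a \<in> perp R Q (E c)"
      using W(3) subset_perp_iff[of R "{p ?a}" Q "E c"] sym by blast
    moreover have "\<not> D (?e c) \<subseteq> perp R Q (E c)"
      using W(2) subset_perp_iff[of R "D (?e c)" Q "E c"] sym DQ by blast
    ultimately show "?a \<in> ?Z"
      unfolding mem_Collect_eq a S_eq[OF c] using W(1) by blast
  qed
  with Z have "(\<lambda>c. nths c A) ` V \<in> fubini_null J m"
    by (rule complete_saturated_ideal.subset_mem[OF fubini_null_complete_saturated[OF J]])
  with V(2) card show False by simp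
qed

text \<open>Reading the merged tuple from left to right keeps the hulls of the two parts related,
  starting from the hull of the common part, which is related to itself.\<close>

lemma merge_related:
  fixes D :: "nat set \<Rightarrow> 'k list \<Rightarrow> 'p set"
  assumes J: "complete_saturated_ideal J \<Lambda>"
    and sym: "\<And>x y. R x y \<Longrightarrow> R y x" and refl: "\<And>x. x \<in> Q \<Longrightarrow> R x x"
    and AB: "A \<union> B = {..<M}" "card A = m" "card B = m" "ranks A B = ranks B A"
    and p: "\<forall>a\<in>X. p a \<in> Q"
    and hull: "\<And>r. r \<subseteq> {..<m} \<Longrightarrow> essential_hull (fubini_null J m) R Q p (\<lambda>a. nths a r) X (D r)"
  shows "{c. length c = M \<and> nths c A \<in> X \<and> nths c B \<in> X \<and> \<not> R (p (nths c A)) (p (nths c B))}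
    \<in> fubini_null J M"
proof -
  interpret N: complete_saturated_ideal "fubini_null J M" \<Lambda>
    by (rule fubini_null_complete_saturated[OF J])
  have A: "A \<subseteq> {..<M}" "finite A" and B: "B \<subseteq> {..<M}" "finite B"
    using AB(1) finite_subset[of _ "{..<M}"] by auto
  have hullA: "essential_hull (fubini_null J m) R Q p (\<lambda>a. nths a (ranks A T)) X (D (ranks A T))" for T
    by (rule hull) (use ranks_subset[OF A(2)] AB(2) in simp)
  have hullB: "essential_hull (fubini_null J m) R Q p (\<lambda>a. nths a (ranks B T)) X (D (ranks B T))" for T
    by (rule hull) (use ranks_subset[OF B(2)] AB(3) in simp)
  \<comment> \<open>These are the hulls of the two parts when the coordinates below \<open>j\<close>
    and the common ones are known. The common coordinates are included from the start, so both hulls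
    begin with the same data.\<close>
  define DA where "DA j c = D (ranks A (B \<union> {..<j})) (nths c (A \<inter> (B \<union> {..<j})))" for j c
  define DB where "DB j c = D (ranks B (A \<union> {..<j})) (nths c (B \<inter> (A \<union> {..<j})))" for j c
  have DA_mem: "p (nths c A) \<in> DA j c" if "nths c A \<in> X" for j c
  proof -
    have "p (nths c A) \<in> D (ranks A (B \<union> {..<j})) (nths (nths c A) (ranks A (B \<union> {..<j})))"
      using hullA that by (simp add: essential_hull_def)
    then show ?thesis unfolding DA_def nths_nths_ranks[OF A(2)] .
  qed
  have DB_mem: "p (nths c B) \<in> DB j c" if "nths c B \<in> X" for j c
  proof -
    have "p (nths c B) \<in> D (ranks B (A \<union> {..<j})) (nths (nths c B) (ranks B (A \<union> {..<j})))"
      using hullB that by (simp add: essential_hull_def)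
    then show ?thesis unfolding DB_def nths_nths_ranks[OF B(2)] .
  qed
  have DA_Q: "DA j c \<subseteq> Q" for j c unfolding DA_def using hullA by (simp add: essential_hull_def)
  have DB_Q: "DB j c \<subseteq> Q" for j c unfolding DB_def using hullB by (simp add: essential_hull_def)
  have DA_det: "DA j c = DA j c'"
    if "length c = M" "length c' = M" "\<forall>i<M. i < j \<or> i \<in> B \<inter> A \<longrightarrow> c ! i = c' ! i" for j c c'
  proof -
    have "nths c (A \<inter> (B \<union> {..<j})) = nths c' (A \<inter> (B \<union> {..<j}))"
      using that by (subst nths_eq_iff) auto
    then show ?thesis by (simp add: DA_def)
  qed
  have DB_det: "DB j c = DB j c'"
    if "length c = M" "length c' = M" "\<forall>i<M. i < j \<or> i \<in> A \<inter> B \<longrightarrow> c ! i = c' ! i" for j c c'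
  proof -
    have "nths c (B \<inter> (A \<union> {..<j})) = nths c' (B \<inter> (A \<union> {..<j}))"
      using that by (subst nths_eq_iff) auto
    then show ?thesis by (simp add: DB_def)
  qed
  have stepA: "{c. length c = M \<and> nths c A \<in> X \<and> related R (DA j c) (DB j c) \<and>
      \<not> related R {p (nths c A)} (DB j c)} \<in> fubini_null J M" if "j \<le> M" for j
    unfolding DA_def
    by (rule merge_step[OF J sym A(1) AB(2) that p hullA DB_Q DB_det])
  have stepB: "{c. length c = M \<and> nths c B \<in> X \<and> related R (DB j c) (DA j c) \<and>
      \<not> related R {p (nths c B)} (DA j c)} \<in> fubini_null J M" if "j \<le> M" for j
    unfolding DB_def
    by (rule merge_step[OF J sym B(1) AB(3) that p hullB DA_Q DA_det])
  let ?bad = "\<lambda>j. {c. length c = M \<and> nths c A \<in> X \<and> nths c B \<in> X \<and> \<not> related R (DA j c) (DB j c)}"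
  have bad: "?bad j \<in> fubini_null J M" if "j \<le> M" for j
    using that
  proof (induction j)
    case 0
    \<comment> \<open>The common coordinates have the same ranks in both parts, so the two hulls are
      equal. They contain \<open>p (nths c A)\<close>, which is related to itself.\<close>
    have "related R (DA 0 c) (DB 0 c)" if "nths c A \<in> X" for c
    proof -
      have "DA 0 c = DB 0 c" by (simp add: DA_def DB_def AB(4) Int_commute)
      moreover have "R (p (nths c A)) (p (nths c A))" using refl p that by blast
      ultimately show ?thesis unfolding related_def using DA_mem[OF that, of 0] by auto
    qed
    then have "?bad 0 = {}" by blast
    then show ?case using N.empty_mem by (simp only:)
  next
    case (Suc j)
    then have IH: "?bad j \<in> fubini_null J M" and j: "j < M" by simp_all
    show ?case
    proof (cases "j \<in> B")
      case True
      \<comment> \<open>Reading a coordinate of \<open>B\<close> leaves the hull of the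
        \<open>A\<close> part unchanged: if it is common, it was known before.\<close>
      have "A \<inter> (B \<union> {..<Suc j}) = A \<inter> (B \<union> {..<j})" using True by (auto simp: less_Suc_eq)
      then have DA_Suc: "DA (Suc j) = DA j"
        using ranks_cong[of A "B \<union> {..<Suc j}" "B \<union> {..<j}"] by (intro ext) (simp add: DA_def)
      show ?thesis
      proof (cases "j \<in> A")
        case True
        have "B \<inter> (A \<union> {..<Suc j}) = B \<inter> (A \<union> {..<j})" using True by (auto simp: less_Suc_eq)
        then have "DB (Suc j) = DB j"
          using ranks_cong[of B "A \<union> {..<Suc j}" "A \<union> {..<j}"] by (intro ext) (simp add: DB_def)
        with DA_Suc IH show ?thesis by simp
      next
        case False
        \<comment> \<open>Only the hull of the \<open>B\<close> part changes. Outside the null set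
          of \<open>stepB\<close>, \<open>p (nths c B)\<close> is related to the unchanged
          \<open>DA j c\<close>, and it lies in the new hull.\<close>
        have "?bad (Suc j) \<subseteq> ?bad j \<union> {c. length c = M \<and> nths c B \<in> X \<and> related R (DB j c) (DA j c) \<and>
            \<not> related R {p (nths c B)} (DA j c)}"
        proof
          fix c assume c: "c \<in> ?bad (Suc j)"
          have "\<not> related R {p (nths c B)} (DA j c)"
          proof
            assume "related R {p (nths c B)} (DA j c)"
            then obtain x where "x \<in> DA j c" "R x (p (nths c B))" using sym by (auto simp: related_def)
            with DA_Suc DB_mem[of c "Suc j"] c show False by (auto simp: related_def)
          qed
          moreover have "related R (DA j c) (DB j c) \<Longrightarrow> related R (DB j c) (DA j c)"
            using related_sym sym by blast
          ultimately show "c \<in> ?bad j \<union> {c. length c = M \<and> nths c B \<in> X \<and> related R (DB j c) (DA j c) \<and>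
            \<not> related R {p (nths c B)} (DA j c)}" using c by blast
        qed
        then show ?thesis
          by (rule N.subset_mem[OF N.Un_mem[OF IH stepB[OF less_imp_le[OF j]]]])
      qed
    next
      case False
      then have "B \<inter> (A \<union> {..<Suc j}) = B \<inter> (A \<union> {..<j})" by (auto simp: less_Suc_eq)
      then have DB_Suc: "DB (Suc j) = DB j"
        using ranks_cong[of B "A \<union> {..<Suc j}" "A \<union> {..<j}"] by (intro ext) (simp add: DB_def)
      have "?bad (Suc j) \<subseteq> ?bad j \<union> {c. length c = M \<and> nths c A \<in> X \<and> related R (DA j c) (DB j c) \<and>
          \<not> related R {p (nths c A)} (DB j c)}"
      proof
        fix c assume c: "c \<in> ?bad (Suc j)"
        have "\<not> related R {p (nths c A)} (DB j c)"
          using c DA_mem[of c "Suc j"] unfolding DB_Suc related_def by blast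
        then show "c \<in> ?bad j \<union> {c. length c = M \<and> nths c A \<in> X \<and> related R (DA j c) (DB j c) \<and>
          \<not> related R {p (nths c A)} (DB j c)}" using c by blast
      qed
      then show ?thesis
        by (rule N.subset_mem[OF N.Un_mem[OF IH stepA[OF less_imp_le[OF j]]]])
    qed
  qed
  \<comment> \<open>It remains to pass from the hulls at \<open>j = M\<close> to the values. First
    \<open>stepA\<close> replaces the hull of the \<open>A\<close> part by
    \<open>p (nths c A)\<close>, then \<open>last\<close> does the same for \<open>B\<close> with
    this value as test set. Intersecting with \<open>Q\<close> makes the test set admissible for
    every \<open>c\<close>.\<close>
  let ?E = "\<lambda>c. {p (nths c A)} \<inter> Q"
  have last: "{c. length c = M \<and> nths c B \<in> X \<and> related R (DB M c) (?E c) \<and>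
      \<not> related R {p (nths c B)} (?E c)} \<in> fubini_null J M"
    unfolding DB_def
  proof (rule merge_step[OF J sym B(1) AB(3) order_refl p hullB])
    fix c c' :: "'k list"
    assume c: "length c = M" "length c' = M" "\<forall>i<M. i < M \<or> i \<in> B \<inter> A \<longrightarrow> c ! i = c' ! i"
    then have "c = c'" by (intro nth_equalityI) auto
    then show "?E c = ?E c'" by simp
  qed (assumption, rule Int_lower2)
  have "{c. length c = M \<and> nths c A \<in> X \<and> nths c B \<in> X \<and> \<not> R (p (nths c A)) (p (nths c B))} \<subseteq>
    ?bad M \<union> {c. length c = M \<and> nths c A \<in> X \<and> related R (DA M c) (DB M c) \<and>
      \<not> related R {p (nths c A)} (DB M c)} \<union>
    {c. length c = M \<and> nths c B \<in> X \<and> related R (DB M c) (?E c) \<and> \<not> related R {p (nths c B)} (?E c)}"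
    (is "_ \<subseteq> ?U")
  proof
    fix c assume "c \<in> {c. length c = M \<and> nths c A \<in> X \<and> nths c B \<in> X \<and> \<not> R (p (nths c A)) (p (nths c B))}"
    then have c: "length c = M" "nths c A \<in> X" "nths c B \<in> X" "\<not> R (p (nths c A)) (p (nths c B))"
      by simp_all
    have "?E c = {p (nths c A)}" using p c(2) by blast
    moreover have "\<not> related R {p (nths c B)} {p (nths c A)}"
      using c(4) sym by (auto simp: related_def)
    moreover have "related R {p (nths c A)} (DB M c) \<Longrightarrow> related R (DB M c) {p (nths c A)}"
      using related_sym sym by blast
    ultimately show "c \<in> ?U" using c by (cases "related R {p (nths c A)} (DB M c)") auto
  qed
  then show ?thesis
    by (rule N.subset_mem[OF N.Un_mem[OF N.Un_mem[OF bad[OF order_refl] stepA[OF order_refl]] last]])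
qed

text \<open>The tuple \<open>c\<close> lists the union in increasing order, and \<open>A\<close>,
  \<open>B\<close> are the positions of the entries of \<open>a\<close>, \<open>b\<close>. The
  bijection fixes a common entry and maps the entries of \<open>a\<close> below it onto those of
  \<open>b\<close> below it, whence the equation for the ranks. The bound on \<open>M\<close> leaves
  finitely many types.\<close>

lemma similar_merge:
  fixes a b :: "'k::wellorder list"
  assumes a: "a \<in> tuples m" and b: "b \<in> tuples m" and sim: "similar (set a) (set b)"
  obtains M A B c where "M \<le> 2 * m" "A \<union> B = {..<M}" "card A = m" "card B = m" "ranks A B = ranks B A"
    "c \<in> tuples M" "set c = set a \<union> set b" "nths c A = a" "nths c B = b"
proof -
  define c where "c = sorted_list_of_set (set a \<union> set b)"
  have c: "set c = set a \<union> set b" "sorted_wrt (<) c" by (simp_all add: c_def)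
  define pos where "pos S = {i. i < length c \<and> c ! i \<in> S}" for S
  have nths_pos: "nths c (pos (set d)) = d" "card (pos (set d)) = m"
    if d: "d \<in> tuples m" "set d \<subseteq> set c" for d
  proof -
    have *: "nths c (pos (set d)) = filter (\<lambda>x. x \<in> set d) c"
      by (simp add: filter_eq_nths pos_def)
    have "filter (\<lambda>x. x \<in> set d) c = d"
      by (rule strict_sorted_equal) (use d c in \<open>auto simp: tuples_def intro: sorted_wrt_filter\<close>)
    with * show "nths c (pos (set d)) = d" by simp
    then have "card {i. i < length c \<and> i \<in> pos (set d)} = length d"
      using length_nths[of c "pos (set d)"] by simp
    then show "card (pos (set d)) = m" using d(1) by (simp add: pos_def tuples_def)
  qed
  have less_iff: "c ! i < c ! k \<longleftrightarrow> i < k" if "i < length c" "k < length c" for i k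
    using sorted_wrt_nth_less[OF c(2)] that by (metis linorder_neqE_nat order_less_asym order_less_irrefl)
  have rank: "card {i' \<in> pos S. i' < i} = card {y \<in> S. y < c ! i}"
    if "i < length c" "S \<subseteq> set c" for i S
  proof (rule bij_betw_same_card[of "(!) c"])
    have "inj_on ((!) c) {i' \<in> pos S. i' < i}"
      using c(2) by (intro inj_on_nth) (auto simp: strict_sorted_iff pos_def)
    moreover have "(!) c ` {i' \<in> pos S. i' < i} = {y \<in> S. y < c ! i}"
    proof (intro equalityI subsetI)
      fix y assume y: "y \<in> {y \<in> S. y < c ! i}"
      with that(2) obtain k where "k < length c" "y = c ! k" by (metis (lifting) in_set_conv_nth mem_Collect_eq subsetD)
      with y that(1) show "y \<in> (!) c ` {i' \<in> pos S. i' < i}" using less_iff by (auto simp: pos_def)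
    qed (use that(1) less_iff in \<open>auto simp: pos_def\<close>)
    ultimately show "bij_betw ((!) c) {i' \<in> pos S. i' < i} {y \<in> S. y < c ! i}"
      by (simp add: bij_betw_def)
  qed
  obtain f where f: "bij_betw f (set a) (set b)" "strict_mono_on (set a) f" "\<forall>x\<in>set a \<inter> set b. f x = x"
    using sim by (auto simp: similar_def)
  have "card {y \<in> set a. y < z} = card {y \<in> set b. y < z}" if z: "z \<in> set a" "z \<in> set b" for z
  proof (rule bij_betw_same_card[of f])
    have fz: "f z = z" using f(3) z by blast
    have iff: "f y < z \<longleftrightarrow> y < z" if "y \<in> set a" for y
      using strict_mono_on_less[OF f(2) that z(1)] fz by simp
    have "inj_on f {y \<in> set a. y < z}"
      using f(1) by (auto simp: bij_betw_def intro: inj_on_subset)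
    moreover have "f ` {y \<in> set a. y < z} = {y \<in> set b. y < z}"
    proof (intro equalityI subsetI)
      fix y assume "y \<in> f ` {y \<in> set a. y < z}"
      then obtain x where "x \<in> set a" "x < z" "y = f x" by auto
      then show "y \<in> {y \<in> set b. y < z}" using iff[of x] bij_betwE[OF f(1)] by simp
    next
      fix y assume y: "y \<in> {y \<in> set b. y < z}"
      then obtain x where "x \<in> set a" "y = f x" using bij_betw_imp_surj_on[OF f(1)] by auto
      then show "y \<in> f ` {y \<in> set a. y < z}" using iff[of x] y by simp
    qed
    ultimately show "bij_betw f {y \<in> set a. y < z} {y \<in> set b. y < z}"
      by (simp add: bij_betw_def)
  qed
  then have "card {i' \<in> pos (set a). i' < i} = card {i' \<in> pos (set b). i' < i}"
    if "i \<in> pos (set a) \<inter> pos (set b)" for i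
    using that rank[of i "set a"] rank[of i "set b"] c(1) by (simp add: pos_def)
  then have ranks: "ranks (pos (set a)) (pos (set b)) = ranks (pos (set b)) (pos (set a))"
    unfolding ranks_def Int_commute[of "pos (set b)"] by (intro image_cong) auto
  have "length c = card (set c)" using c(2) by (simp add: distinct_card strict_sorted_iff)
  also have "\<dots> \<le> card (set a) + card (set b)" unfolding c(1) by (rule card_Un_le)
  also have "\<dots> \<le> length a + length b" by (intro add_mono card_length)
  finally have "length c \<le> 2 * m" using a b by (simp add: tuples_def)
  moreover have "pos (set a) \<union> pos (set b) = {..<length c}"
    using c(1) nth_mem[of _ c] by (auto simp: pos_def)
  moreover have "c \<in> tuples (length c)" using c(2) by (simp add: tuples_def)
  ultimately show ?thesis
    using that[of "length c" "pos (set a)" "pos (set b)" c] nths_pos[OF a] nths_pos[OF b] ranks c(1)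
    by simp
qed

section \<open>The Knaster property\<close>

text \<open>For each of the finitely many types, \<open>merge_related\<close> and
  \<open>diagonal_homogeneous\<close> give a set in the dual filter whose tuples are all good. The
  tuples of \<open>X'\<close> with entries in the intersection of these sets still form a positive
  set.\<close>

lemma homogeneous_subset:
  fixes X :: "'k::wellorder list set"
  assumes J: "complete_saturated_ideal J \<Lambda>" and normal: "normal_ideal J"
    and R: "half_graph_free R Q" "\<And>x y. R x y \<Longrightarrow> R y x" "\<And>x. x \<in> Q \<Longrightarrow> R x x"
    and X: "X \<subseteq> tuples m" "X \<notin> fubini_null J m" and p: "\<forall>a\<in>X. p a \<in> Q"
  shows "\<exists>Y\<subseteq>X. Y \<notin> fubini_null J m \<and>
    (\<forall>a\<in>Y. \<forall>b\<in>Y. similar (set a) (set b) \<longrightarrow> R (p a) (p b))"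
proof -
  interpret J: complete_saturated_ideal J \<Lambda> by (rule J)
  interpret Jm: complete_saturated_ideal "fubini_null J m" \<Lambda>
    by (rule fubini_null_complete_saturated[OF J])
  have "finite (Pow {..<m})" by simp
  from Jm.essential_hulls_exist[OF this R(1) X(2) p, of "\<lambda>r a. nths a r"]
  obtain X' D where X': "X' \<subseteq> X" "X' \<notin> fubini_null J m"
    and hull: "\<forall>r\<in>Pow {..<m}. essential_hull (fubini_null J m) R Q p (\<lambda>a. nths a r) X' (D r)"
    by (elim exE conjE)
  have p': "\<forall>a\<in>X'. p a \<in> Q" using p X'(1) by blast
  define types where "types = {(M, A, B). M \<le> 2 * m \<and> A \<union> B = {..<M} \<and> card A = m \<and> card B = m \<and>
      ranks A B = ranks B A}"
  have "types \<subseteq> {..2 * m} \<times> Pow {..<2 * m} \<times> Pow {..<2 * m}"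
  proof
    fix \<tau> assume "\<tau> \<in> types"
    then obtain M A B where \<tau>: "\<tau> = (M, A, B)" "M \<le> 2 * m" "A \<union> B = {..<M}"
      by (auto simp: types_def)
    then have "A \<union> B \<subseteq> {..<2 * m}" by simp
    with \<tau>(1,2) show "\<tau> \<in> {..2 * m} \<times> Pow {..<2 * m} \<times> Pow {..<2 * m}" by simp
  qed
  then have fin: "finite types" by (rule finite_subset) simp
  let ?Z = "\<lambda>A B. {c. nths c A \<in> X' \<and> nths c B \<in> X' \<longrightarrow> R (p (nths c A)) (p (nths c B))}"
  have "\<forall>\<tau>\<in>types. \<exists>H. - H \<in> J \<and>
      (\<forall>c\<in>tuples (fst \<tau>). set c \<subseteq> H \<longrightarrow> c \<in> ?Z (fst (snd \<tau>)) (snd (snd \<tau>)))"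
  proof
    fix \<tau> assume "\<tau> \<in> types"
    then obtain M A B where \<tau>: "\<tau> = (M, A, B)" and
      AB: "A \<union> B = {..<M}" "card A = m" "card B = m" "ranks A B = ranks B A"
      by (auto simp: types_def)
    have "{c. length c = M \<and> nths c A \<in> X' \<and> nths c B \<in> X' \<and> \<not> R (p (nths c A)) (p (nths c B))}
        \<in> fubini_null J M"
      by (rule merge_related[OF J R(2,3) AB p' bspec[OF hull PowI]])
    then have "tuples M - ?Z A B \<in> fubini_null J M"
      by (rule complete_saturated_ideal.subset_mem[OF fubini_null_complete_saturated[OF J]])
        (auto simp: tuples_def)
    from diagonal_homogeneous[OF J normal this]
    show "\<exists>H. - H \<in> J \<and>
        (\<forall>c\<in>tuples (fst \<tau>). set c \<subseteq> H \<longrightarrow> c \<in> ?Z (fst (snd \<tau>)) (snd (snd \<tau>)))"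
      unfolding \<tau> fst_conv snd_conv .
  qed
  from bchoice[OF this] obtain H where H: "\<forall>\<tau>\<in>types. - H \<tau> \<in> J \<and>
      (\<forall>c\<in>tuples (fst \<tau>). set c \<subseteq> H \<tau> \<longrightarrow> c \<in> ?Z (fst (snd \<tau>)) (snd (snd \<tau>)))" ..
  define K where "K = (\<Inter>\<tau>\<in>types. H \<tau>)"
  have "(\<Union>\<tau>\<in>types. - H \<tau>) \<in> J"
    by (rule J.UN_mem) (use H J.finite_card_le[OF fin] in blast)+
  moreover have "- K = (\<Union>\<tau>\<in>types. - H \<tau>)" by (auto simp: K_def)
  ultimately have "- K \<in> J" by simp
  define Y where "Y = X' \<inter> {a. set a \<subseteq> K}"
  have "Y \<notin> fubini_null J m"
  proof
    assume "Y \<in> fubini_null J m"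
    then have "Y \<union> {a. \<not> set a \<subseteq> K} \<in> fubini_null J m"
      using fubini_null_not_subset[OF J \<open>- K \<in> J\<close>] by (rule Jm.Un_mem)
    then have "X' \<in> fubini_null J m"
      by (rule Jm.subset_mem) (auto simp: Y_def)
    with X'(2) show False by contradiction
  qed
  moreover have "R (p a) (p b)" if ab: "a \<in> Y" "b \<in> Y" "similar (set a) (set b)" for a b
  proof -
    have aX: "a \<in> X'" "set a \<subseteq> K" and bX: "b \<in> X'" "set b \<subseteq> K" using ab by (auto simp: Y_def)
    then have "a \<in> tuples m" "b \<in> tuples m" using X(1) X'(1) by blast+
    then obtain M A B c where c: "M \<le> 2 * m" "A \<union> B = {..<M}" "card A = m" "card B = m"
        "ranks A B = ranks B A" "c \<in> tuples M" "set c = set a \<union> set b" "nths c A = a" "nths c B = b"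
      using ab(3) by (rule similar_merge)
    have \<tau>: "(M, A, B) \<in> types" using c(1-5) by (simp add: types_def)
    have "set c \<subseteq> H (M, A, B)" using c(7) aX(2) bX(2) \<tau> by (auto simp: K_def)
    then have "c \<in> ?Z A B" using bspec[OF H \<tau>] c(6) by simp
    then show ?thesis using c(8,9) aX(1) bX(1) by simp
  qed
  moreover have "Y \<subseteq> X" using X'(1) by (auto simp: Y_def)
  ultimately show ?thesis by blast
qed

text \<open>On \<open>\<omega>\<close> the predecessor function would contradict normality, so some initial segment
  is infinite.\<close>

lemma complete_saturated_ideal_of_normal:
  fixes J :: "'k::wellorder set set" and \<nu> :: 'k
  assumes card: "is_cardinal TYPE('k)" and proper: "proper_ideal J" and uniform: "uniform_ideal J"
    and normal: "normal_ideal J" and sat: "saturated \<nu> J"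
  obtains \<mu> :: 'k where "complete_saturated_ideal J {..<\<mu>}"
proof -
  have J: "{} \<in> J" "UNIV \<notin> J" "\<And>X Y. X \<in> J \<Longrightarrow> Y \<subseteq> X \<Longrightarrow> Y \<in> J" "\<And>X Y. X \<in> J \<Longrightarrow> Y \<in> J \<Longrightarrow> X \<union> Y \<in> J"
    using proper unfolding proper_ideal_def by blast+
  have diag: "{\<beta>. \<exists>\<alpha><\<beta>. \<beta> \<in> X \<alpha>} \<in> J" if "\<And>\<alpha>. X \<alpha> \<in> J" for X
    using normal that by (simp add: normal_ideal_def)
  let ?r = "{(x :: 'k, y). x \<le> y}"
  have r: "card_order ?r" using card by (simp add: is_cardinal_def)
  have seg_less: "|{..<\<alpha>}| <o |UNIV :: 'k set|" for \<alpha> :: 'k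
  proof -
    have "|underS ?r \<alpha>| <o ?r"
      using card_order_on_Card_order[OF r] by (intro card_of_underS) auto
    moreover have "underS ?r \<alpha> = {..<\<alpha>}" by (auto simp: underS_def)
    ultimately show ?thesis using ordLess_ordIso_trans[OF _ card_of_unique[OF r]] by simp
  qed
  have seg: "{..<\<alpha>} \<in> J" for \<alpha>
    using uniform seg_less unfolding uniform_ideal_def by blast
  \<comment> \<open>The constant sequence provides two distinct points, so that singletons are
    smaller than the whole type and hence in \<open>J\<close>.\<close>
  obtain i j :: 'k where "i < j"
    using sat[unfolded saturated_def, rule_format, of "\<lambda>_. UNIV"] J(2)
    by (auto simp: positive_sets_def)
  have single: "{x} \<in> J" for x
  proof -
    have "|{x}| \<le>o |{..<j}|" using \<open>i < j\<close> by (intro card_of_singl_ordLeq) auto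
    then have "|{x}| <o |UNIV :: 'k set|" using seg_less by (rule ordLeq_ordLess_trans)
    then show ?thesis using uniform by (simp add: uniform_ideal_def)
  qed
  have "\<exists>\<mu>\<ge>\<nu>. infinite {..<\<mu>}"
  proof (rule ccontr)
    assume "\<not> ?thesis"
    then have "finite {..<\<mu>}" if "\<nu> \<le> \<mu>" for \<mu> using that by blast
    then have fin: "finite {..<\<beta>}" for \<beta> :: 'k
      by (rule finite_subset[rotated, of "{..<max \<nu> \<beta>}"]) auto
    \<comment> \<open>This set contains at most the immediate successor of \<open>\<alpha>\<close>.
      If all initial segments are finite, every point except the least is such a successor, so the
      diagonal union is almost everything.\<close>
    let ?X = "\<lambda>\<alpha>. {\<beta>. \<alpha> < \<beta> \<and> (\<forall>\<gamma><\<beta>. \<gamma> \<le> \<alpha>)}"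
    have "?X \<alpha> \<in> J" for \<alpha>
    proof (cases "?X \<alpha> = {}")
      case False
      then obtain \<beta> where \<beta>: "\<beta> \<in> ?X \<alpha>" by blast
      have "\<gamma> = \<beta>" if "\<gamma> \<in> ?X \<alpha>" for \<gamma>
        using \<beta> that by (metis (lifting) leD linorder_neqE mem_Collect_eq)
      then have "?X \<alpha> \<subseteq> {\<beta>}" by blast
      then show ?thesis using J(3) single by blast
    qed (simp only: J(1))
    then have "{\<beta>. \<exists>\<alpha><\<beta>. \<beta> \<in> ?X \<alpha>} \<in> J" by (rule diag)
    then have "{\<beta>. \<exists>\<alpha><\<beta>. \<beta> \<in> ?X \<alpha>} \<union> {LEAST x. True} \<in> J" using single J(4) by blast
    moreover have "(UNIV :: 'k set) \<subseteq> {\<beta>. \<exists>\<alpha><\<beta>. \<beta> \<in> ?X \<alpha>} \<union> {LEAST x. True}"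
    proof (rule subsetI)
      fix \<beta> :: 'k
      show "\<beta> \<in> {\<beta>. \<exists>\<alpha><\<beta>. \<beta> \<in> ?X \<alpha>} \<union> {LEAST x. True}"
      proof (cases "\<beta> = (LEAST x. True)")
        case False
        then have "(LEAST x. True) < \<beta>" using Least_le[of "\<lambda>_. True" \<beta>] by simp
        then have ne: "{..<\<beta>} \<noteq> {}" by blast
        have "Max {..<\<beta>} < \<beta>" using Max_in[OF fin ne] by simp
        moreover have "\<forall>\<gamma><\<beta>. \<gamma> \<le> Max {..<\<beta>}" using fin by simp
        ultimately show ?thesis by blast
      qed (rule UnI2, simp)
    qed
    ultimately have "UNIV \<in> J" by (rule J(3))
    with J(2) show False by contradiction
  qed
  then obtain \<mu> where \<mu>: "\<nu> \<le> \<mu>" "infinite {..<\<mu>}" by blast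
  have "complete_saturated_ideal J {..<\<mu>}"
  proof
    show "infinite {..<\<mu>}" by (rule \<mu>(2))
  next
    fix X Y assume "X \<in> J" "Y \<subseteq> X"
    then show "Y \<in> J" by (rule J(3))
  next
    fix \<F> assume \<F>: "\<F> \<subseteq> J" "|\<F>| \<le>o |{..<\<mu>}|"
    show "\<Union>\<F> \<in> J"
    proof (cases "\<F> = {}")
      case False
      from card_of_ordLeq2[THEN iffD2, OF this \<F>(2)] obtain g where g: "g ` {..<\<mu>} = \<F>" ..
      have "g \<alpha> \<in> J" if "\<alpha> < \<mu>" for \<alpha> using g \<F>(1) that by blast
      \<comment> \<open>The family is padded with empty sets. From \<open>\<mu>\<close> on, its
        union agrees with the diagonal union, and the points below \<open>\<mu>\<close> form a set
        in \<open>J\<close>.\<close>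
      then have "(if \<alpha> < \<mu> then g \<alpha> else {}) \<in> J" for \<alpha> using J(1) by simp
      then have "{\<beta>. \<exists>\<alpha><\<beta>. \<beta> \<in> (if \<alpha> < \<mu> then g \<alpha> else {})} \<in> J" by (rule diag)
      then have "{\<beta>. \<exists>\<alpha><\<beta>. \<beta> \<in> (if \<alpha> < \<mu> then g \<alpha> else {})} \<union> {..<\<mu>} \<in> J"
        using seg J(4) by blast
      moreover have "\<Union>\<F> \<subseteq> {\<beta>. \<exists>\<alpha><\<beta>. \<beta> \<in> (if \<alpha> < \<mu> then g \<alpha> else {})} \<union> {..<\<mu>}"
      proof
        fix \<beta> assume "\<beta> \<in> \<Union>\<F>"
        then obtain \<alpha> where \<alpha>: "\<alpha> < \<mu>" "\<beta> \<in> g \<alpha>" using g by auto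
        show "\<beta> \<in> {\<beta>. \<exists>\<alpha><\<beta>. \<beta> \<in> (if \<alpha> < \<mu> then g \<alpha> else {})} \<union> {..<\<mu>}"
        proof (cases "\<beta> < \<mu>")
          case False
          then have "\<alpha> < \<beta>" using \<alpha>(1) by simp
          with \<alpha> show ?thesis by auto
        qed simp
      qed
      ultimately show ?thesis by (rule J(3))
    qed (simp add: J(1))
  next
    fix \<F> :: "'k set set" assume dis: "pairwise disjnt \<F>" and pos: "\<F> \<inter> J = {}"
    show "|\<F>| \<le>o |{..<\<mu>}|"
    proof (rule ccontr)
      assume "\<not> |\<F>| \<le>o |{..<\<mu>}|"
      then have "|{..<\<mu>}| <o |\<F>|"
        unfolding not_ordLeq_iff_ordLess[OF card_of_Well_order card_of_Well_order] .
      then have "|{..<\<mu>}| \<le>o |\<F>|" by (rule ordLess_imp_ordLeq)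
      then obtain h where h: "inj_on h {..<\<mu>}" "h ` {..<\<mu>} \<subseteq> \<F>"
        unfolding card_of_ordLeq[symmetric] by (elim exE conjE)
      \<comment> \<open>Since \<open>\<nu> \<le> \<mu>\<close>, the family contains a sequence of
        length \<open>\<nu>\<close> of disjoint positive sets, against saturation.\<close>
      have "\<forall>i<\<nu>. h i \<in> positive_sets J"
        using h(2) pos \<mu>(1) by (force simp: positive_sets_def)
      then obtain i j where ij: "i < j" "j < \<nu>" "h i \<inter> h j \<in> positive_sets J"
        using sat unfolding saturated_def by blast
      then have "i < \<mu>" "j < \<mu>" using \<mu>(1) by simp_all
      then have "h i \<in> \<F>" "h j \<in> \<F>" "h i \<noteq> h j" using h ij(1) by (auto simp: inj_on_def)
      then have "disjnt (h i) (h j)" using dis by (simp add: pairwise_def)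
      with ij(3) J(1) show False by (simp add: disjnt_def positive_sets_def)
    qed
  qed
  then show ?thesis by (rule that)
qed

theorem theorem1p11:
  fixes J :: "'k::wellorder set set"
    and \<nu> :: 'k
    and n :: nat
    and P :: "'p set"
    and le :: "'p rel"
  assumes "is_cardinal TYPE('k)"
    and "proper_ideal J"
    and "uniform_ideal J"
    and "normal_ideal J"
    and "saturated \<nu> J"
    and "partial_order_on P le"
    and "sigma_w_finite_cc P le"
  shows "fubini_Knaster J (n + 1) P le"
proof -
  obtain \<mu> :: 'k where J: "complete_saturated_ideal J {..<\<mu>}"
    by (rule complete_saturated_ideal_of_normal[OF assms(1-5)])
  interpret N: complete_saturated_ideal "fubini_null J (Suc n)" "{..<\<mu>}"
    by (rule fubini_null_complete_saturated[OF J])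
  obtain A :: "nat \<Rightarrow> 'p set" where A: "P = (\<Union>k. A k)"
    and free: "\<And>k. half_graph_free (compatible P le) (A k)"
    using assms(7) unfolding sigma_w_finite_cc_def half_graph_free_def by blast
  have positive: "X \<in> fubini_positive J (Suc n) \<longleftrightarrow> X \<notin> fubini_null J (Suc n)"
    if "X \<subseteq> tuples (Suc n)" for X
    using fubini_power_iff_null[OF that, of J] that unfolding fubini_positive_def by blast
  have sym: "compatible P le x y \<Longrightarrow> compatible P le y x" for x y
    unfolding compatible_def by blast
  have refl: "compatible P le x x" if "x \<in> A k" for x k
  proof -
    have "x \<in> P" using A that by blast
    moreover from this have "(x, x) \<in> le"
      using assms(6) by (auto simp: partial_order_on_def preorder_on_def refl_on_def)
    ultimately show ?thesis unfolding compatible_def by blast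
  qed
  show ?thesis
    unfolding fubini_Knaster_def Suc_eq_plus1[symmetric]
  proof (intro ballI allI impI)
    fix X and p :: "'k list \<Rightarrow> 'p"
    assume X: "X \<in> fubini_positive J (Suc n)" and p: "\<forall>a\<in>X. p a \<in> P"
    have tuples: "X \<subseteq> tuples (Suc n)" using X by (simp add: fubini_positive_def)
    have "X = (\<Union>k. {a \<in> X. p a \<in> A k})" using p A by blast
    \<comment> \<open>By countable completeness some piece \<open>A k\<close> contains
      \<open>p a\<close> for a positive set of \<open>a\<close>.\<close>
    then have "\<exists>k. {a \<in> X. p a \<in> A k} \<notin> fubini_null J (Suc n)"
      using N.UN_nat_mem[of "\<lambda>k. {a \<in> X. p a \<in> A k}"] X positive[OF tuples] by metis
    then obtain k where k: "{a \<in> X. p a \<in> A k} \<notin> fubini_null J (Suc n)" ..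
    have "{a \<in> X. p a \<in> A k} \<subseteq> tuples (Suc n)" "\<forall>a\<in>{a \<in> X. p a \<in> A k}. p a \<in> A k"
      using tuples by auto
    then have "\<exists>Y\<subseteq>{a \<in> X. p a \<in> A k}. Y \<notin> fubini_null J (Suc n) \<and>
        (\<forall>a\<in>Y. \<forall>b\<in>Y. similar (set a) (set b) \<longrightarrow> compatible P le (p a) (p b))"
      using k by (intro homogeneous_subset[OF J assms(4) free[of k]]) (rule sym refl, assumption)+
    then obtain Y where Y: "Y \<subseteq> {a \<in> X. p a \<in> A k}" "Y \<notin> fubini_null J (Suc n)"
      "\<forall>a\<in>Y. \<forall>b\<in>Y. similar (set a) (set b) \<longrightarrow> compatible P le (p a) (p b)"
      by (elim exE conjE)
    then have "Y \<in> fubini_positive J (Suc n)" using positive[of Y] tuples by blast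
    with Y show "\<exists>Y\<in>fubini_positive J (Suc n). Y \<subseteq> X \<and>
        (\<forall>a\<in>Y. \<forall>b\<in>Y. similar (set a) (set b) \<longrightarrow> compatible P le (p a) (p b))" by blast
  qed
qed

end
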